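(* Let $\kappa,\lambda\in(0,1)$ with $\kappa^2+\lambda^2=1$, and let $\theta\in(0,\pi/6)$ be the angle with $\lambda=\cos 3\theta$ (equivalently $\kappa=\sin 3\theta$). Let $-x_2\in(-2,0)$ and $-x_3\in(-3,-2)$ denote the two negative zeros of the cubic $g(x)=x^3+3x^2-4\lambda^2$. Then the negative critical values $\mathrm{dn}_3(K+\mathrm{i}K')=-x_2$ and $\mathrm{dn}_3(\mathrm{i}K')=-x_3$ of $\mathrm{dn}_3$ are given by $$x_2=1+2\cos(2\theta+\pi/3)=1+\cos 2\theta-\sqrt3\,\sin 2\theta$$ and $$x_3=1+2\cos(2\theta-\pi/3)=1+\cos 2\theta+\sqrt3\,\sin 2\theta.$$
   Context: $F(a,b;c;z)$ is the Gauss hypergeometric function ${}_2F_1$. Let $\phi$ be the analytic local inverse near $0$, with $\phi(0)=0$, of $f(T)=\int_0^T F(\tfrac13,\tfrac23;\tfrac12;\kappa^2\sin^2 t)\,dt$. The function $\mathrm{dn}_3$ is defined near $0$ by $\mathrm{dn}_3=\phi'$; it extends (uniquely) to an elliptic function on $\mathbb{C}$, also denoted $\mathrm{dn}_3$, namely $$\mathrm{dn}_3=1-\frac{\frac49\kappa^2}{\frac13+\wp},$$ where $\wp$ is the Weierstrass function (satisfying $(\wp')^2=4\wp^3-g_2\wp-g_3$, with a double pole at $0$) with invariants $g_2=\frac{4}{27}(1+8\lambda^2)$ and $g_3=\frac{8}{729}(8\lambda^4+20\lambda^2-1)$. The invariants are real and $g_2^3-27g_3^2>0$, so the period lattice of $\wp$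 (which is also that of $\mathrm{dn}_3$) is rectangular: it is $\{2mK+2n\,\mathrm{i}K' : m,n\in\mathbb{Z}\}$ with $K>0$ and $K'>0$, which defines $K$ and $K'$. A critical value of $\mathrm{dn}_3$ is a value assumed at a point where $\mathrm{dn}_3'=0$. *)

theory Defs
  imports "HOL-Complex_Analysis.Complex_Analysis"
begin

text \<open>The Gauss series; it represents \<open>F(a,b;c;z)\<close> for \<open>\<bar>z\<bar> < 1\<close> only, which is the range needed
  for the germ at \<open>0\<close> considered below.\<close>

definition gauss_hypergeo :: "complex \<Rightarrow> complex \<Rightarrow> complex \<Rightarrow> complex \<Rightarrow> complex" where
  "gauss_hypergeo a b c z = eval_fps (fps_hypergeo [a, b] [c] 1) z"

definition hypergeo_integral :: "real \<Rightarrow> complex \<Rightarrow> complex" where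
  "hypergeo_integral \<kappa> T =
     contour_integral (linepath 0 T)
       (\<lambda>t. gauss_hypergeo (1/3) (2/3) (1/2) ((of_real \<kappa>)\<^sup>2 * (sin t)\<^sup>2))"

definition analytic_local_inverse_at_0 :: "(complex \<Rightarrow> complex) \<Rightarrow> (complex \<Rightarrow> complex) \<Rightarrow> bool" where
  "analytic_local_inverse_at_0 f \<phi> \<longleftrightarrow>
     \<phi> analytic_on {0} \<and> \<phi> 0 = 0 \<and>
     (\<forall>\<^sub>F z in nhds 0. f (\<phi> z) = z) \<and> (\<forall>\<^sub>F z in nhds 0. \<phi> (f z) = z)"

definition period_lattice :: "(complex \<Rightarrow> complex) \<Rightarrow> complex set" where
  "period_lattice f = {\<omega>. \<forall>z. f (z + \<omega>) = f z}"

text \<open>Meromorphic functions are total functions with the library's convention that the value at a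
  pole is \<open>0\<close>, so periods can be tested pointwise.  The condition on \<open>\<omega>\<^sub>2 / \<omega>\<^sub>1\<close> is linear
  independence over the reals; it includes \<open>\<omega>\<^sub>1 \<noteq> 0\<close> because \<open>x / 0 = 0\<close>.\<close>

definition elliptic :: "(complex \<Rightarrow> complex) \<Rightarrow> bool" where
  "elliptic f \<longleftrightarrow> f nicely_meromorphic_on UNIV \<and>
     (\<exists>\<omega>\<^sub>1 \<in> period_lattice f. \<exists>\<omega>\<^sub>2 \<in> period_lattice f. Im (\<omega>\<^sub>2 / \<omega>\<^sub>1) \<noteq> 0)"

text \<open>\<open>P\<close> is the Weierstrass function with invariants \<open>g\<^sub>2\<close>, \<open>g\<^sub>3\<close>.  The differential equation
  determines a nonconstant meromorphic solution up to translation, and the pole at \<open>0\<close> fixes the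
  translation.\<close>

definition is_weierstrass_p :: "complex \<Rightarrow> complex \<Rightarrow> (complex \<Rightarrow> complex) \<Rightarrow> bool" where
  "is_weierstrass_p g\<^sub>2 g\<^sub>3 P \<longleftrightarrow>
     elliptic P \<and> is_pole P 0 \<and> zorder P 0 = -2 \<and>
     (\<forall>z. \<not> is_pole P z \<longrightarrow> (deriv P z)\<^sup>2 = 4 * P z ^ 3 - g\<^sub>2 * P z - g\<^sub>3)"

text \<open>Poles do not contribute: there the function is not continuous, hence has no derivative.\<close>

definition critical_point :: "(complex \<Rightarrow> complex) \<Rightarrow> complex \<Rightarrow> bool" where
  "critical_point f z \<longleftrightarrow> (f has_field_derivative 0) (at z)"

definition critical_values :: "(complex \<Rightarrow> complex) \<Rightarrow> complex set" where
  "critical_values f = f ` {z. critical_point f z}"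

end

theory Submission
  imports Defs
begin

text \<open>
  With \<open>sin s = \<kappa> sin \<phi>\<close>, the identity \<open>F(1/3,2/3;1/2;sin\<^sup>2 s) cos s = cos (s/3)\<close> gives
  \<open>dn\<^sub>3 = 4 cos\<^sup>2 (s/3) - 3\<close> near \<open>0\<close>, whence \<open>dn\<^sub>3\<close> satisfies a second order differential equation
  \<open>d'' = p(d)\<close> with \<open>d(0) = 1\<close>, \<open>d'(0) = 0\<close>. The function \<open>1 - c / (P + 1/3)\<close> with \<open>c = 4\<kappa>\<^sup>2/9\<close> solves
  the same initial value problem, so both agree near \<open>0\<close> and hence everywhere. Uniqueness for the
  reciprocal of \<open>P\<close> also shows that \<open>P\<close> is even, commutes with conjugation and has its poles
  exactly at the periods. Therefore \<open>P\<close> is real on the edges of the rectangle spanned by the half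
  periods. There \<open>(P')\<^sup>2\<close> is nonnegative on horizontal and nonpositive on vertical edges, which confines
  \<open>P\<close> to intervals between roots of the Weierstrass cubic and, starting from the pole at \<open>0\<close>, decides
  which root is taken at which half period. The critical values of \<open>dn\<^sub>3\<close> are the images of these roots.
\<close>

subsection \<open>Analytic solutions of second order equations\<close>

lemma DERIV_eventually_eqI:
  assumes "(f has_field_derivative D) (at z)" "\<forall>\<^sub>F w in nhds z. g w = f w"
  shows "(g has_field_derivative D) (at z)"
  using assms DERIV_cong_ev[OF refl assms(2) refl, of D] by blast

lemma eventually_analytic_at:
  assumes "f analytic_on {z}"
  shows "\<forall>\<^sub>F w in nhds z. f analytic_on {w}"
proof -
  obtain S where S: "open S" "z \<in> S" "f holomorphic_on S"
    using assms by (auto simp: analytic_at)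
  have "\<forall>\<^sub>F w in nhds z. w \<in> S" using S by (intro eventually_nhds_in_open)
  thus ?thesis by eventually_elim (use S in \<open>auto simp: analytic_at\<close>)
qed

lemma factor_step:
  fixes U V Q R h a :: "'a :: comm_ring_1"
  assumes "Q - R = (U - V) * h"
  shows "(a + U * Q) - (a + V * R) = (U - V) * (Q + V * h)"
proof -
  have "Q = R + (U - V) * h"
    using assms by (metis add.commute diff_add_cancel)
  show ?thesis unfolding \<open>Q = R + (U - V) * h\<close> by (simp add: algebra_simps)
qed

text \<open>Horner's scheme divides \<open>p(u) - p(v)\<close> by \<open>u - v\<close>, and the
  cofactor is built from \<open>u\<close> and \<open>v\<close>, hence analytic. This makes the
  equation for the difference of two solutions linear.\<close>

lemma poly_diff_factor_analytic:
  fixes u v :: "complex \<Rightarrow> complex"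
  assumes "u analytic_on S" "v analytic_on S"
  shows "\<exists>h. h analytic_on S \<and> (\<forall>z. poly p (u z) - poly p (v z) = (u z - v z) * h z)"
proof (induction p)
  case 0
  show ?case by (intro exI[of _ "\<lambda>_. 0"]) auto
next
  case (pCons a q)
  then obtain h where h: "h analytic_on S"
    "\<And>z. poly q (u z) - poly q (v z) = (u z - v z) * h z" by blast
  have "poly (pCons a q) (u z) - poly (pCons a q) (v z)
      = (u z - v z) * (poly q (u z) + v z * h z)" for z
    unfolding poly_pCons by (rule factor_step[OF h(2)])
  moreover have "(\<lambda>z. poly q (u z) + v z * h z) analytic_on S"
  proof -
    have "poly q analytic_on UNIV"
      by (simp add: analytic_on_open poly_holomorphic_on)
    hence "(\<lambda>z. poly q (u z)) analytic_on S"
      using analytic_on_compose_gen[OF assms(1), of "poly q" UNIV] by (simp add: o_def)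
    thus ?thesis using assms h(1) by (intro analytic_intros)
  qed
  ultimately show ?case by blast
qed

text \<open>The difference of the Taylor series satisfies a linear equation
  \<open>D'' = D * H\<close>, which expresses every coefficient of \<open>D\<close> from order 2 on
  through earlier ones. The initial conditions annihilate the first two.\<close>

lemma analytic_second_order_ode_unique:
  assumes u: "u analytic_on {0}" and v: "v analytic_on {0}"
    and init: "u 0 = v 0" "deriv u 0 = deriv v 0"
    and odeu: "\<forall>\<^sub>F z in nhds 0. deriv (deriv u) z = poly p (u z)"
    and odev: "\<forall>\<^sub>F z in nhds 0. deriv (deriv v) z = poly p (v z)"
  shows "\<forall>\<^sub>F z in nhds 0. u z = v z"
proof -
  obtain h where h: "h analytic_on {0}"
    "\<And>z. poly p (u z) - poly p (v z) = (u z - v z) * h z"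
    using poly_diff_factor_analytic[OF u v] by blast
  define F G H where "F = fps_expansion u 0" "G = fps_expansion v 0" "H = fps_expansion h 0"
  have F: "u has_fps_expansion F" and G: "v has_fps_expansion G" and H: "h has_fps_expansion H"
    unfolding F_G_H_def by (intro analytic_at_imp_has_fps_expansion_0 u v h(1))+
  have "(\<lambda>z. deriv (deriv u) z - deriv (deriv v) z) has_fps_expansion
          fps_deriv (fps_deriv F) - fps_deriv (fps_deriv G)"
    by (intro fps_expansion_intros F G)
  moreover have "(\<lambda>z. (u z - v z) * h z) has_fps_expansion (F - G) * H"
    by (intro fps_expansion_intros F G H)
  moreover have "\<forall>\<^sub>F z in nhds 0. deriv (deriv u) z - deriv (deriv v) z = (u z - v z) * h z"
    using odeu odev by eventually_elim (simp add: h(2))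
  ultimately have "(\<lambda>z. (u z - v z) * h z) has_fps_expansion
          fps_deriv (fps_deriv F) - fps_deriv (fps_deriv G)"
      "(\<lambda>z. (u z - v z) * h z) has_fps_expansion (F - G) * H"
    by (simp_all cong: has_fps_expansion_cong)
  hence E: "fps_deriv (fps_deriv F) - fps_deriv (fps_deriv G) = (F - G) * H"
    by (rule fps_expansion_unique_complex)
  have "(F - G) $ n = 0" for n
  proof (induction n rule: less_induct)
    case (less n)
    have "n = 0 \<or> n = 1 \<or> n = Suc (Suc (n - 2))" by linarith
    then consider "n = 0" | "n = 1" | m where "n = Suc (Suc m)" by blast
    thus ?case
    proof cases
      case 1
      thus ?thesis using init(1) fps_nth_fps_expansion[OF F, of 0] fps_nth_fps_expansion[OF G, of 0]
        by simp
    next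
      case 2
      thus ?thesis using init(2) fps_nth_fps_expansion[OF F, of 1] fps_nth_fps_expansion[OF G, of 1]
        by simp
    next
      case 3
      have "(fps_deriv (fps_deriv (F - G))) $ m = ((F - G) * H) $ m"
        using E by simp
      \<comment> \<open>The coefficient of order \<open>m\<close> of \<open>(F - G) * H\<close>
        involves \<open>F - G\<close> only up to order \<open>m\<close>, which lies below
        \<open>n = m + 2\<close>.\<close>
      also have "\<dots> = 0"
        unfolding fps_mult_nth using less 3 by (intro sum.neutral) auto
      finally have "of_nat (m + 1) * (of_nat (m + 1 + 1) * (F - G) $ n) = 0"
        unfolding 3 fps_deriv_nth by (simp only: Suc_eq_plus1)
      moreover have "(of_nat (m + 1) :: complex) \<noteq> 0" "(of_nat (m + 1 + 1) :: complex) \<noteq> 0"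
        unfolding of_nat_eq_0_iff by simp_all
      ultimately show ?thesis by (metis mult_eq_0_iff)
    qed
  qed
  hence "F = G" by (simp add: fps_eq_iff)
  hence "\<forall>\<^sub>F z in nhds 0. eval_fps F z = u z" "\<forall>\<^sub>F z in nhds 0. eval_fps F z = v z"
    using F G by (auto simp: has_fps_expansion_def)
  thus ?thesis by eventually_elim simp
qed

subsection \<open>The reciprocal of a Weierstrass function\<close>

text \<open>The case \<open>z = 0\<close> fills the removable singularity that the pole of
  \<open>P\<close> leaves there; the function serves only through its germ at
  \<open>0\<close>.\<close>

definition wp_recip :: "complex \<Rightarrow> (complex \<Rightarrow> complex) \<Rightarrow> complex \<Rightarrow> complex" where
  "wp_recip a P z = (if z = 0 then 0 else inverse (P z + a))"

text \<open>If \<open>(P')\<^sup>2 = 4P\<^sup>3 - g\<^sub>2P - g\<^sub>3\<close>, then \<open>W = 1/(P + a)\<close> satisfies \<open>(W')\<^sup>2 = R(W)\<close> with a quartic \<open>R\<close>, and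
  \<open>W'' = R'(W)/2\<close>, which is the following polynomial. Unlike the first order equation, this one
  determines \<open>W\<close> from \<open>W(0) = W'(0) = 0\<close>.\<close>

definition wp_recip_poly :: "complex \<Rightarrow> complex \<Rightarrow> complex \<Rightarrow> complex poly" where
  "wp_recip_poly a g2 g3 = [:2, - 12 * a, 3/2 * (12 * a\<^sup>2 - g2), 2 * (a * g2 - 4 * a ^ 3 - g3):]"

text \<open>Differentiating the quartic equation for \<open>(W')^2\<close> gives
  \<open>2 W' W'' = R'(W) W'\<close>. As \<open>W\<close> is not constant, \<open>W'\<close> has no
  zeros in some punctured neighbourhood of \<open>0\<close> and cancels there; continuity settles
  the point \<open>0\<close>.\<close>

lemma wp_recip_ode:
  fixes P :: "complex \<Rightarrow> complex"
  assumes iso: "isolated_singularity_at P 0" and pole: "is_pole P 0"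
    and ode: "\<forall>\<^sub>F z in at 0. (deriv P z)\<^sup>2 = 4 * P z ^ 3 - g2 * P z - g3"
  shows "wp_recip a P analytic_on {0}" and "wp_recip a P 0 = 0" and "deriv (wp_recip a P) 0 = 0"
    and "\<forall>\<^sub>F z in nhds 0. deriv (deriv (wp_recip a P)) z = poly (wp_recip_poly a g2 g3) (wp_recip a P z)"
proof -
  define W where "W = wp_recip a P"
  have "is_pole (\<lambda>z. P z + a) 0"
    using pole is_pole_plus_const_iff by blast
  hence nz: "\<forall>\<^sub>F z in at 0. P z + a \<noteq> 0"
    by (rule non_zero_neighbour_pole)
  obtain r where r: "r > 0" "P analytic_on ball 0 r - {0}"
    using iso by (auto simp: isolated_singularity_at_def)
  obtain s where s: "s > 0" "\<And>z. z \<in> ball 0 s - {0} \<Longrightarrow>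
      P z + a \<noteq> 0 \<and> (deriv P z)\<^sup>2 = 4 * P z ^ 3 - g2 * P z - g3"
    using eventually_conj[OF nz ode] unfolding eventually_at
    by (auto simp: dist_commute)
  define U where "U = (ball 0 (min r s) :: complex set)"
  have U: "open U" "0 \<in> U" "connected U"
    using r s by (auto simp: U_def)
  have Uan: "P analytic_on {z}" and Unz: "P z + a \<noteq> 0"
    and Uode: "(deriv P z)\<^sup>2 = 4 * P z ^ 3 - g2 * P z - g3" if "z \<in> U" "z \<noteq> 0" for z
    using that s(2)[of z] analytic_on_subset[OF r(2), of "{z}"] by (auto simp: U_def)
  have hol: "W holomorphic_on U"
  proof -
    have "(\<lambda>z. P z + a) holomorphic_on U - {0}"
      by (intro holomorphic_intros) (use Uan in \<open>auto intro!: analytic_imp_holomorphic simp: analytic_on_analytic_at[of _ "U - {0}"]\<close>)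
    hence "(\<lambda>x. if x = 0 then 0 else inverse (P x + a)) holomorphic_on U"
      using U \<open>is_pole (\<lambda>z. P z + a) 0\<close> Unz by (intro is_pole_inverse_holomorphic) auto
    thus ?thesis by (simp add: W_def wp_recip_def [abs_def])
  qed
  have anW: "W analytic_on U"
    using hol U analytic_on_open by blast
  have W0: "W 0 = 0" by (simp add: W_def wp_recip_def)
  have Wnz: "W z \<noteq> 0" if "z \<in> U" "z \<noteq> 0" for z
    using that Unz by (simp add: W_def wp_recip_def)
  have hol': "deriv W holomorphic_on U" and hol'': "deriv (deriv W) holomorphic_on U"
    using hol U by (auto intro!: holomorphic_deriv)
  have first: "(deriv W z)\<^sup>2 = 4 * W z - 12 * a * W z ^ 2 + (12 * a\<^sup>2 - g2) * W z ^ 3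
      + (a * g2 - 4 * a ^ 3 - g3) * W z ^ 4" (is "_ = ?C z") if z: "z \<in> U" for z
  proof -
    have *: "(deriv W z)\<^sup>2 = ?C z" if z: "z \<in> U" "z \<noteq> 0" for z
    proof -
      have "(P has_field_derivative deriv P z) (at z)"
        using Uan[OF z] by (simp add: analytic_on_imp_differentiable_at DERIV_deriv_iff_field_differentiable)
      hence "((\<lambda>z. inverse (P z + a)) has_field_derivative - (deriv P z / (P z + a)\<^sup>2)) (at z)"
        using Unz[OF z] by (auto intro!: derivative_eq_intros simp: field_simps power2_eq_square)
      moreover have "\<forall>\<^sub>F w in nhds z. W w = inverse (P w + a)"
        using t1_space_nhds[OF z(2)] by eventually_elim (auto simp: W_def wp_recip_def)
      ultimately have "(W has_field_derivative - (deriv P z / (P z + a)\<^sup>2)) (at z)"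
        by (rule DERIV_eventually_eqI)
      hence "deriv W z = - (deriv P z / (P z + a)\<^sup>2)"
        by (rule DERIV_imp_deriv)
      hence "(deriv W z)\<^sup>2 = (deriv P z)\<^sup>2 * (inverse (P z + a)) ^ 4"
        by (simp add: power_divide divide_inverse power_mult_distrib power_inverse flip: power_mult)
      also have "\<dots> = (4 * P z ^ 3 - g2 * P z - g3) * W z ^ 4"
        using z Uode by (simp add: W_def wp_recip_def)
      \<comment> \<open>The relation \<open>W (P + a) = 1\<close> eliminates \<open>P\<close>: the
        cubic in \<open>P\<close> times \<open>W^4\<close> becomes a quartic in
        \<open>W\<close>.\<close>
      also have "\<dots> = ?C z"
      proof -
        have q: "W z * (P z + a) = 1" using Unz[OF z] z by (simp add: W_def wp_recip_def)
        show ?thesis using q by algebra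
      qed
      finally show ?thesis .
    qed
    show ?thesis
    \<comment> \<open>Both sides are holomorphic on all of \<open>U\<close>, so continuation
      supplies the point \<open>0\<close>.\<close>
    proof (rule analytic_continuation_open[where f = "\<lambda>z. (deriv W z)\<^sup>2" and g = ?C and s = "U - {0}" and s' = U])
      show "U - {0} \<noteq> {}" using U by (metis insert_Diff not_open_singleton)
    qed (use U * hol hol' z in \<open>auto intro!: holomorphic_intros\<close>)
  qed
  have W'0: "deriv W 0 = 0" using first[of 0] U W0 by simp
  have nc: "\<forall>\<^sub>F z in at 0. deriv W z \<noteq> 0"
  proof (rule ccontr)
    assume "\<not> ?thesis"
    hence "\<exists>\<^sub>F z in at 0. deriv W z = 0" by (simp add: frequently_def)
    moreover have "deriv W nicely_meromorphic_on U"
      using hol' U by (simp add: analytic_on_imp_nicely_meromorphic_on analytic_on_open)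
    ultimately have "deriv W z = 0" if "z \<in> U" for z
      using frequently_eq_meromorphic_imp_constant U that by blast
    hence "W constant_on U"
      using U hol by (intro has_field_derivative_0_imp_constant_on)
        (metis holomorphic_derivI)+
    hence "W z = 0" if "z \<in> U" for z using that W0 U by (auto simp: constant_on_def)
    moreover obtain z where "z \<in> U" "z \<noteq> 0" using U by (metis UNIV_I open_contains_cball insertI1 not_open_singleton singletonD subsetI subset_antisym singletonI empty_subsetI insert_subset)
    ultimately show False using Wnz by blast
  qed
  let ?p = "poly (wp_recip_poly a g2 g3)"
  have ev: "\<forall>\<^sub>F z in at 0. deriv (deriv W) z = ?p (W z)"
  proof -
    have "\<forall>\<^sub>F z in at 0. z \<in> U" using U by (simp add: eventually_at_in_open')
    with nc show ?thesis
    proof eventually_elim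
      case (elim z)
      have dW: "(W has_field_derivative deriv W z) (at z)"
        "(deriv W has_field_derivative deriv (deriv W) z) (at z)"
        using hol hol' U elim by (auto intro: holomorphic_derivI)
      have "((\<lambda>z. (deriv W z)\<^sup>2) has_field_derivative 2 * deriv W z * deriv (deriv W) z) (at z)"
        by (rule derivative_eq_intros dW refl | simp)+
      moreover have "((\<lambda>z. (deriv W z)\<^sup>2) has_field_derivative 2 * ?p (W z) * deriv W z) (at z)"
      proof -
        have "((\<lambda>z. 4 * W z - 12 * a * W z ^ 2 + (12 * a\<^sup>2 - g2) * W z ^ 3
              + (a * g2 - 4 * a ^ 3 - g3) * W z ^ 4) has_field_derivative 2 * ?p (W z) * deriv W z) (at z)"
          by (rule derivative_eq_intros dW refl | simp)+
             (simp add: wp_recip_poly_def algebra_simps power2_eq_square power3_eq_cube)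
        moreover have "\<forall>\<^sub>F w in nhds z. w \<in> U" using U elim by (simp add: eventually_nhds_in_open)
        then have "\<forall>\<^sub>F w in nhds z. (deriv W w)\<^sup>2 = 4 * W w - 12 * a * W w ^ 2 + (12 * a\<^sup>2 - g2) * W w ^ 3
              + (a * g2 - 4 * a ^ 3 - g3) * W w ^ 4"
          by eventually_elim (rule first)
        ultimately show ?thesis by (rule DERIV_eventually_eqI)
      qed
      ultimately have "2 * deriv W z * deriv (deriv W) z = 2 * ?p (W z) * deriv W z"
        by (rule DERIV_unique)
      thus ?case using elim by simp
    qed
  qed
  have "deriv (deriv W) 0 = ?p (W 0)"
  proof (rule LIM_unique)
    have "isCont (deriv (deriv W)) 0"
      using hol'' U by (meson continuous_on_eq_continuous_at holomorphic_on_imp_continuous_on)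
    thus "deriv (deriv W) \<midarrow>0\<rightarrow> deriv (deriv W) 0" by (simp add: isCont_def)
    have "isCont W 0"
      using hol U by (meson continuous_on_eq_continuous_at holomorphic_on_imp_continuous_on)
    hence "isCont (\<lambda>z. ?p (W z)) 0" by (intro continuous_intros)
    hence "(\<lambda>z. ?p (W z)) \<midarrow>0\<rightarrow> ?p (W 0)" by (simp add: isCont_def)
    thus "deriv (deriv W) \<midarrow>0\<rightarrow> ?p (W 0)"
      using ev by (subst tendsto_cong) auto
  qed
  with ev have "\<forall>\<^sub>F z in nhds 0. deriv (deriv W) z = ?p (W z)"
    by (auto simp: eventually_at_filter elim: eventually_mono)
  thus "\<forall>\<^sub>F z in nhds 0. deriv (deriv (wp_recip a P)) z = ?p (wp_recip a P z)"
    by (simp add: W_def)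
  show "wp_recip a P analytic_on {0}"
    using anW U by (auto simp: W_def intro: analytic_on_subset)
  show "wp_recip a P 0 = 0" "deriv (wp_recip a P) 0 = 0" using W0 W'0 by (simp_all add: W_def)
qed

subsection \<open>Symmetries of the Weierstrass function\<close>

text \<open>Off a sparse set, a meromorphic function on the plane is either zero or nonzero
  throughout; vanishing near \<open>a\<close> rules out the second case for
  \<open>f - g\<close>.\<close>

lemma meromorphic_identity:
  assumes "f meromorphic_on UNIV" "g meromorphic_on UNIV" "\<forall>\<^sub>F w in at a. f w = g w"
  shows "\<forall>\<^sub>F w in at z. f w = g w"
proof -
  have "(\<lambda>w. f w - g w) meromorphic_on UNIV"
    using assms by (intro meromorphic_intros)
  moreover have "\<not> (\<forall>\<^sub>F w in cosparse UNIV. f w - g w \<noteq> 0)"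
  proof
    assume "\<forall>\<^sub>F w in cosparse UNIV. f w - g w \<noteq> 0"
    hence "\<forall>\<^sub>F w in at a. f w - g w \<noteq> 0"
      by (rule eventually_cosparse_imp_eventually_at) simp
    with assms(3) have "\<forall>\<^sub>F w in at a. False" by eventually_elim simp
    thus False by simp
  qed
  ultimately have "\<forall>\<^sub>F w in cosparse UNIV. f w - g w = 0"
    using meromorphic_imp_constant_or_avoid[of _ UNIV 0] by blast
  hence "\<forall>\<^sub>F w in at z. f w - g w = 0"
    by (rule eventually_cosparse_imp_eventually_at) simp
  thus ?thesis by simp
qed

lemma nicely_meromorphic_tendsto:
  assumes "f nicely_meromorphic_on UNIV" "\<not> is_pole f z"
  shows "f \<midarrow>z\<rightarrow> f z"
  using assms by (auto simp: nicely_meromorphic_on_def)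

lemma nicely_meromorphic_value:
  assumes f: "f nicely_meromorphic_on UNIV" and lim: "f \<midarrow>z\<rightarrow> L"
  shows "f z = L"
proof -
  have "\<not> is_pole f z"
    using lim unfolding is_pole_def by (metis not_tendsto_and_filterlim_at_infinity trivial_limit_at)
  from LIM_unique[OF nicely_meromorphic_tendsto[OF f this] lim] show ?thesis .
qed

text \<open>Functions that agree on a punctured neighbourhood have the same kind of singularity: at
  a common pole both values are \<open>0\<close> by convention, otherwise both are the common
  limit.\<close>

lemma nicely_meromorphic_eqI:
  assumes f: "f nicely_meromorphic_on UNIV" and g: "g nicely_meromorphic_on UNIV"
    and ev: "\<forall>\<^sub>F w in at z. f w = g w"
  shows "f z = g z"
proof (cases "is_pole f z")
  case True
  hence "is_pole g z" using is_pole_cong[OF ev refl] by simp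
  with True show ?thesis
    using is_pole_zero_at_nicely_mero[OF f True] is_pole_zero_at_nicely_mero[OF g] by simp
next
  case False
  hence "\<not> is_pole g z" using is_pole_cong[OF ev refl] by simp
  hence "g \<midarrow>z\<rightarrow> g z" by (rule nicely_meromorphic_tendsto[OF g])
  hence "f \<midarrow>z\<rightarrow> g z" using tendsto_cong[OF ev] by blast
  thus ?thesis
    using LIM_unique nicely_meromorphic_tendsto[OF f False] by blast
qed

section \<open>Composition with affine maps and with conjugation\<close>

lemma nicely_meromorphic_compose:
  assumes f: "f nicely_meromorphic_on UNIV" and m: "(\<lambda>z. f (g z)) meromorphic_on UNIV"
    and lim: "\<And>z. filterlim g (at (g z)) (at z)"
  shows "(\<lambda>z. f (g z)) nicely_meromorphic_on UNIV"
proof -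
  have "is_pole (\<lambda>z. f (g z)) z \<and> f (g z) = 0 \<or> (\<lambda>z. f (g z)) \<midarrow>z\<rightarrow> f (g z)" for z
  proof (cases "is_pole f (g z)")
    case True
    thus ?thesis
      using filterlim_compose[OF _ lim[of z], of f at_infinity] is_pole_zero_at_nicely_mero[OF f True]
      by (auto simp: is_pole_def)
  next
    case False
    thus ?thesis
      using filterlim_compose[OF nicely_meromorphic_tendsto[OF f False] lim[of z]] by simp
  qed
  thus ?thesis using m by (simp add: nicely_meromorphic_on_def)
qed

lemma filterlim_affine_at:
  fixes a b z :: complex
  assumes "b \<noteq> 0"
  shows "filterlim (\<lambda>w. a + b * w) (at (a + b * z)) (at z)"
  unfolding filterlim_at
proof
  show "\<forall>\<^sub>F w in at z. a + b * w \<in> UNIV \<and> a + b * w \<noteq> a + b * z"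
    using eventually_neq_at_within[of z z UNIV] by (rule eventually_mono) (use assms in auto)
  show "((\<lambda>w. a + b * w) \<longlongrightarrow> a + b * z) (at z)" by (intro tendsto_intros)
qed

lemma nicely_meromorphic_affine:
  assumes f: "f nicely_meromorphic_on UNIV" and b: "b \<noteq> 0"
  shows "(\<lambda>z. f (a + b * z)) nicely_meromorphic_on UNIV"
proof (rule nicely_meromorphic_compose[OF f _ filterlim_affine_at[OF b]])
  have "(\<lambda>z. a + b * z) analytic_on UNIV" by (intro analytic_intros)
  thus "(\<lambda>z. f (a + b * z)) meromorphic_on UNIV"
    using f by (rule_tac meromorphic_on_compose[of f UNIV]) (auto simp: nicely_meromorphic_on_def)
qed

lemma filterlim_cnj_at: "filterlim cnj (at (cnj z)) (at z)"
  unfolding filterlim_at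
proof
  show "\<forall>\<^sub>F w in at z. cnj w \<in> UNIV \<and> cnj w \<noteq> cnj z"
    using eventually_neq_at_within[of z z UNIV] by (rule eventually_mono) auto
  show "(cnj \<longlongrightarrow> cnj z) (at z)" by (intro tendsto_intros)
qed

lemma deriv_cnj_cnj:
  assumes "f field_differentiable at (cnj z)"
  shows "((\<lambda>w. cnj (f (cnj w))) has_field_derivative cnj (deriv f (cnj z))) (at z)"
  using has_field_derivative_cnj_cnj[of f "deriv f (cnj z)" z] assms
  by (simp add: DERIV_deriv_iff_field_differentiable o_def)

lemma filterlim_cnj_at_infinity: "filterlim cnj at_infinity at_infinity"
  by (rule filterlim_at_infinity_conv_norm_at_top[THEN iffD2])
     (simp add: filterlim_norm_at_top)

text \<open>Conjugating twice restores complex differentiability although \<open>cnj\<close> is not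
  analytic; poles and finite limits at \<open>cnj z\<close> pass through both conjugations.\<close>

lemma meromorphic_cnj_cnj:
  assumes f: "f meromorphic_on UNIV"
  shows "(\<lambda>z. cnj (f (cnj z))) meromorphic_on UNIV"
  unfolding meromorphic_on_altdef
proof (intro ballI conjI)
  fix z :: complex
  have iso: "isolated_singularity_at f (cnj z)" and ne: "not_essential f (cnj z)"
    using f by (auto simp: meromorphic_on_altdef)
  obtain r where r: "r > 0" "f analytic_on ball (cnj z) r - {cnj z}"
    using iso by (auto simp: isolated_singularity_at_def)
  have "(\<lambda>w. cnj (f (cnj w))) holomorphic_on ball z r - {z}"
    unfolding holomorphic_on_def
  proof
    fix w assume "w \<in> ball z r - {z}"
    hence "cnj w \<in> ball (cnj z) r - {cnj z}"
      by (simp add: dist_norm flip: complex_cnj_diff)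
    hence "f field_differentiable at (cnj w)"
      using r(2) analytic_on_imp_differentiable_at by blast
    thus "(\<lambda>w. cnj (f (cnj w))) field_differentiable at w within ball z r - {z}"
      using deriv_cnj_cnj field_differentiable_def field_differentiable_at_within by blast
  qed
  thus "isolated_singularity_at (\<lambda>z. cnj (f (cnj z))) z"
    using r(1) by (intro isolated_singularity_at_holomorphic[of _ "ball z r"]) auto
  show "not_essential (\<lambda>z. cnj (f (cnj z))) z"
  proof (cases "is_pole f (cnj z)")
    case True
    hence "filterlim (\<lambda>w. f (cnj w)) at_infinity (at z)"
      unfolding is_pole_def by (rule filterlim_compose[OF _ filterlim_cnj_at])
    hence "is_pole (\<lambda>z. cnj (f (cnj z))) z"
      unfolding is_pole_def by (rule filterlim_compose[OF filterlim_cnj_at_infinity])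
    thus ?thesis by blast
  next
    case False
    then obtain c where "f \<midarrow>cnj z\<rightarrow> c" using ne by (auto simp: not_essential_def)
    hence "(\<lambda>w. f (cnj w)) \<midarrow>z\<rightarrow> c" by (rule filterlim_compose[OF _ filterlim_cnj_at])
    hence "(\<lambda>w. cnj (f (cnj w))) \<midarrow>z\<rightarrow> cnj c" by (intro tendsto_intros)
    thus ?thesis by blast
  qed
qed

lemma nicely_meromorphic_cnj_cnj:
  assumes f: "f nicely_meromorphic_on UNIV"
  shows "(\<lambda>z. cnj (f (cnj z))) nicely_meromorphic_on UNIV"
proof -
  have "is_pole (\<lambda>z. cnj (f (cnj z))) z \<and> cnj (f (cnj z)) = 0
      \<or> (\<lambda>z. cnj (f (cnj z))) \<midarrow>z\<rightarrow> cnj (f (cnj z))" for z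
  proof (cases "is_pole f (cnj z)")
    case True
    hence "filterlim (\<lambda>w. f (cnj w)) at_infinity (at z)"
      unfolding is_pole_def by (rule filterlim_compose[OF _ filterlim_cnj_at])
    hence "is_pole (\<lambda>z. cnj (f (cnj z))) z"
      unfolding is_pole_def by (rule filterlim_compose[OF filterlim_cnj_at_infinity])
    thus ?thesis using is_pole_zero_at_nicely_mero[OF f True] by simp
  next
    case False
    hence "(\<lambda>w. f (cnj w)) \<midarrow>z\<rightarrow> f (cnj z)"
      by (rule filterlim_compose[OF nicely_meromorphic_tendsto[OF f] filterlim_cnj_at])
    thus ?thesis by (auto intro: tendsto_intros)
  qed
  thus ?thesis
    using f meromorphic_cnj_cnj by (simp add: nicely_meromorphic_on_def)
qed

section \<open>Symmetries of \<open>P\<close> from its differential equation\<close>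

locale weierstrass_p =
  fixes g2 g3 :: complex and P :: "complex \<Rightarrow> complex"
  assumes wp: "is_weierstrass_p g2 g3 P"
begin

lemma nice: "P nicely_meromorphic_on UNIV"
  using wp by (simp add: is_weierstrass_p_def elliptic_def)

lemma mero: "P meromorphic_on UNIV"
  using nice by (simp add: nicely_meromorphic_on_def)

lemma pole_0: "is_pole P 0"
  using wp by (simp add: is_weierstrass_p_def)

lemma ode: "\<not> is_pole P z \<Longrightarrow> (deriv P z)\<^sup>2 = 4 * P z ^ 3 - g2 * P z - g3"
  using wp by (simp add: is_weierstrass_p_def)

lemma analytic_at: "\<not> is_pole P z \<Longrightarrow> P analytic_on {z}"
  using nicely_meromorphic_on_imp_analytic_at[OF nice] by blast

lemma DERIV: "\<not> is_pole P z \<Longrightarrow> (P has_field_derivative deriv P z) (at z)"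
  using analytic_at analytic_on_imp_differentiable_at DERIV_deriv_iff_field_differentiable by blast

lemma isolated: "isolated_singularity_at P z"
  using mero by (simp add: meromorphic_on_altdef)

lemma eventually_not_pole_at: "\<forall>\<^sub>F w in at z. \<not> is_pole P w"
  by (rule eventually_not_pole[OF isolated])

lemma eventually_avoids: "\<forall>\<^sub>F w in at z. P w \<noteq> a"
proof -
  have "\<not> (\<forall>\<^sub>F w in cosparse UNIV. P w = a)"
  proof
    assume "\<forall>\<^sub>F w in cosparse UNIV. P w = a"
    hence "\<forall>\<^sub>F w in at 0. P w = a"
      by (rule eventually_cosparse_imp_eventually_at) simp
    moreover have "\<forall>\<^sub>F w in at 0. P w \<noteq> a"
      using pole_0 unfolding is_pole_def by (rule filterlim_at_infinity_imp_eventually_ne)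
    ultimately have "\<forall>\<^sub>F w in at (0 :: complex). False" by eventually_elim simp
    thus False by simp
  qed
  hence "\<forall>\<^sub>F w in cosparse UNIV. P w \<noteq> a"
    using meromorphic_imp_constant_or_avoid[OF mero, of a] by blast
  thus ?thesis by (rule eventually_cosparse_imp_eventually_at) simp
qed

text \<open>The reciprocals of \<open>Q\<close> and \<open>P\<close> solve the same second order
  initial value problem, so they agree near \<open>0\<close>; the identity principle spreads this to
  all points, poles included. The symmetries of \<open>P\<close> rest on applying this to a
  transformed \<open>P\<close>.\<close>

lemma unique:
  assumes Q: "Q nicely_meromorphic_on UNIV" "is_pole Q 0"
    and odeQ: "\<forall>\<^sub>F z in at 0. (deriv Q z)\<^sup>2 = 4 * Q z ^ 3 - g2 * Q z - g3"
  shows "Q z = P z"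
proof -
  have isoQ: "isolated_singularity_at Q 0"
    using Q(1) by (simp add: nicely_meromorphic_on_def meromorphic_on_altdef)
  have odeP: "\<forall>\<^sub>F z in at 0. (deriv P z)\<^sup>2 = 4 * P z ^ 3 - g2 * P z - g3"
    using eventually_not_pole_at by eventually_elim (rule ode)
  note WQ = wp_recip_ode[OF isoQ Q(2) odeQ, of 0]
  note WP = wp_recip_ode[OF isolated pole_0 odeP, of 0]
  have "\<forall>\<^sub>F z in nhds 0. wp_recip 0 Q z = wp_recip 0 P z"
    by (rule analytic_second_order_ode_unique[OF WQ(1) WP(1) _ _ WQ(4) WP(4)])
       (simp_all add: WQ(2,3) WP(2,3))
  hence "\<forall>\<^sub>F z in at 0. Q z = P z"
    unfolding eventually_at_filter by (rule eventually_mono) (auto simp: wp_recip_def split: if_splits)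
  hence "\<forall>\<^sub>F w in at z. Q w = P w"
    using meromorphic_identity[OF _ mero] Q(1) unfolding nicely_meromorphic_on_def by blast
  thus ?thesis by (rule nicely_meromorphic_eqI[OF Q(1) nice])
qed

text \<open>The substitution moves the pole \<open>a\<close> to \<open>0\<close>, and
  \<open>b = 1\<close> or \<open>b = -1\<close> leaves the equation for \<open>(P')^2\<close>
  unchanged. The case \<open>b = 1\<close> makes every pole a period; \<open>a = 0\<close> with
  \<open>b = -1\<close> makes \<open>P\<close> even.\<close>

lemma affine_symmetry:
  assumes pole: "is_pole P a" and b: "b\<^sup>2 = 1"
  shows "P (a + b * z) = P z"
proof (rule unique)
  have b0: "b \<noteq> 0" using b by auto
  show "(\<lambda>z. P (a + b * z)) nicely_meromorphic_on UNIV"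
    by (rule nicely_meromorphic_affine[OF nice b0])
  have lim: "filterlim (\<lambda>z. a + b * z) (at a) (at 0)"
    using filterlim_affine_at[OF b0, of a 0] by simp
  show "is_pole (\<lambda>z. P (a + b * z)) 0"
    using pole unfolding is_pole_def by (rule filterlim_compose[OF _ lim])
  have "\<forall>\<^sub>F z in at 0. \<not> is_pole P (a + b * z)"
    using eventually_not_pole_at[of a] lim by (rule eventually_compose_filterlim)
  thus "\<forall>\<^sub>F z in at 0. (deriv (\<lambda>z. P (a + b * z)) z)\<^sup>2 = 4 * P (a + b * z) ^ 3 - g2 * P (a + b * z) - g3"
  proof eventually_elim
    case (elim z)
    have "((\<lambda>z. a + b * z) has_field_derivative b) (at z)"
      by (auto intro!: derivative_eq_intros)
    hence "((\<lambda>z. P (a + b * z)) has_field_derivative deriv P (a + b * z) * b) (at z)"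
      by (rule DERIV_chain2[where g = "\<lambda>z. a + b * z", OF DERIV[OF elim]])
    hence "deriv (\<lambda>z. P (a + b * z)) z = deriv P (a + b * z) * b"
      by (rule DERIV_imp_deriv)
    thus ?case using ode[OF elim] b by (simp add: power_mult_distrib)
  qed
qed

lemma minus: "P (- z) = P z"
  using affine_symmetry[OF pole_0, of "-1" z] by simp

lemma pole_iff_period: "is_pole P a \<longleftrightarrow> a \<in> period_lattice P"
proof
  assume "is_pole P a"
  thus "a \<in> period_lattice P"
    using affine_symmetry[of a 1] by (simp add: period_lattice_def add.commute)
next
  assume "a \<in> period_lattice P"
  hence eq: "P (- a + 1 * z) = P z" for z
    by (auto simp: period_lattice_def) (metis add.commute diff_add_cancel uminus_add_conv_diff)
  have lim: "filterlim (\<lambda>z. - a + 1 * z) (at 0) (at a)"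
    using filterlim_affine_at[of 1 "- a" a] by simp
  have "filterlim (\<lambda>z. P (- a + 1 * z)) at_infinity (at a)"
    using pole_0 unfolding is_pole_def by (rule filterlim_compose[OF _ lim])
  thus "is_pole P a" unfolding eq is_pole_def .
qed

text \<open>Evenness and the period \<open>2 * h\<close> make \<open>P\<close> symmetric about
  \<open>h\<close>, so the derivative at \<open>h\<close> is its own negative.\<close>

lemma half_period_critical:
  assumes "2 * h \<in> period_lattice P" "\<not> is_pole P h"
  shows "deriv P h = 0"
proof -
  have eq: "P (2 * h - z) = P z" for z
    using assms(1) minus[of z] by (simp add: period_lattice_def) (metis add.commute uminus_add_conv_diff)
  have "((\<lambda>z. 2 * h - z) has_field_derivative - 1) (at h)"
    by (auto intro!: derivative_eq_intros)
  moreover have "(P has_field_derivative deriv P h) (at (2 * h - h))"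
    using DERIV[OF assms(2)] by simp
  ultimately have "((\<lambda>z. P (2 * h - z)) has_field_derivative deriv P h * - 1) (at h)"
    by (rule DERIV_chain2[where g = "\<lambda>z. 2 * h - z", rotated])
  hence "deriv P h = deriv P h * - 1"
    unfolding eq using DERIV[OF assms(2)] DERIV_unique by blast
  thus ?thesis by simp
qed

text \<open>The function \<open>cnj (P (cnj z))\<close> solves the equation with conjugated
  invariants, which is the same equation when these are real.\<close>

lemma real_invariants_cnj:
  assumes "g2 \<in> \<real>" "g3 \<in> \<real>"
  shows "P (cnj z) = cnj (P z)"
proof -
  have "cnj (P (cnj z)) = P z" for z
  proof (rule unique)
    show "(\<lambda>z. cnj (P (cnj z))) nicely_meromorphic_on UNIV"
      by (rule nicely_meromorphic_cnj_cnj[OF nice])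
    have lim: "filterlim cnj (at 0) (at 0)" using filterlim_cnj_at[of 0] by simp
    have "filterlim (\<lambda>w. P (cnj w)) at_infinity (at 0)"
      using pole_0 unfolding is_pole_def by (rule filterlim_compose[OF _ lim])
    thus "is_pole (\<lambda>z. cnj (P (cnj z))) 0"
      unfolding is_pole_def by (rule filterlim_compose[OF filterlim_cnj_at_infinity])
    have "\<forall>\<^sub>F z in at 0. \<not> is_pole P (cnj z)"
      using eventually_not_pole_at[of 0] lim by (rule eventually_compose_filterlim)
    thus "\<forall>\<^sub>F z in at 0. (deriv (\<lambda>z. cnj (P (cnj z))) z)\<^sup>2
        = 4 * cnj (P (cnj z)) ^ 3 - g2 * cnj (P (cnj z)) - g3"
    proof eventually_elim
      case (elim z)
      have "deriv (\<lambda>z. cnj (P (cnj z))) z = cnj (deriv P (cnj z))"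
        using deriv_cnj_cnj DERIV[OF elim] field_differentiable_def DERIV_imp_deriv by blast
      hence "(deriv (\<lambda>z. cnj (P (cnj z))) z)\<^sup>2 = cnj ((deriv P (cnj z))\<^sup>2)"
        by simp
      also have "\<dots> = 4 * cnj (P (cnj z)) ^ 3 - g2 * cnj (P (cnj z)) - g3"
        unfolding ode[OF elim] using assms by (simp add: Reals_cnj_iff)
      finally show ?case .
    qed
  qed
  from this[of "cnj z"] show ?thesis by (metis complex_cnj_cnj)
qed

end

subsection \<open>Values at the half periods of a rectangular lattice\<close>

text \<open>The image of a connected set is an interval, so it cannot have points on both sides of
  the gap between \<open>a\<close> and \<open>b\<close>; the midpoint yields the
  contradiction.\<close>

lemma gap_upper:
  fixes r :: "real \<Rightarrow> real"
  assumes "connected S" "continuous_on S r" "a < b"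
    and gap: "\<And>x. x \<in> S \<Longrightarrow> r x \<le> a \<or> b \<le> r x"
    and xy: "x \<in> S" "y \<in> S" "b \<le> r x"
  shows "b \<le> r y"
proof (rule ccontr)
  assume "\<not> b \<le> r y"
  hence y: "r y \<le> a" using gap xy by blast
  have "connected (r ` S)" using assms by (intro connected_continuous_image)
  hence "(a + b) / 2 \<in> r ` S"
  proof (rule connectedD_interval)
    show "r y \<in> r ` S" "r x \<in> r ` S" using xy by blast+
    show "r y \<le> (a + b) / 2" "(a + b) / 2 \<le> r x" using y xy(3) \<open>a < b\<close> by simp_all
  qed
  then obtain w where "w \<in> S" "r w = (a + b) / 2" by (metis imageE)
  thus False using gap[of w] \<open>a < b\<close> by auto
qed

lemma gap_lower:
  fixes r :: "real \<Rightarrow> real"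
  assumes "connected S" "continuous_on S r" "a < b"
    and gap: "\<And>x. x \<in> S \<Longrightarrow> r x \<le> a \<or> b \<le> r x"
    and xy: "x \<in> S" "y \<in> S" "r x \<le> a"
  shows "r y \<le> a"
  using gap_upper[of S r a b y x] assms by fastforce

lemma cubic_nonnegD:
  fixes t :: real
  assumes "c < b" "b < a" "(t - a) * (t - b) * (t - c) \<ge> 0"
  shows "a \<le> t \<or> (c \<le> t \<and> t \<le> b)"
proof (rule ccontr)
  assume "\<not> ?thesis"
  then consider "t < c" | "b < t" "t < a" by linarith
  thus False
  proof cases
    case 1
    hence "(t - a) * (t - b) > 0" "t - c < 0" using assms by (auto intro: mult_neg_neg)
    hence "(t - a) * (t - b) * (t - c) < 0" by (rule mult_pos_neg)
    thus False using assms by linarith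
  next
    case 2
    hence "(t - a) * (t - b) < 0" "t - c > 0" using assms by (auto intro: mult_neg_pos)
    hence "(t - a) * (t - b) * (t - c) < 0" by (rule mult_neg_pos)
    thus False using assms by linarith
  qed
qed

lemma cubic_nonposD:
  fixes t :: real
  assumes "c < b" "b < a" "(t - a) * (t - b) * (t - c) \<le> 0"
  shows "t \<le> c \<or> (b \<le> t \<and> t \<le> a)"
  using cubic_nonnegD[of "- a" "- b" "- c" "- t"] assms by (auto simp: algebra_simps)

section \<open>The edges of the rectangle spanned by the half periods\<close>

locale rectangular_weierstrass_p = weierstrass_p "complex_of_real g2" "complex_of_real g3" P
  for g2 g3 :: real and P +
  fixes K K' e1 e2 e3 :: real
  assumes K: "K > 0" and K': "K' > 0"
    and lattice: "period_lattice P =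
      {2 * of_int m * of_real K + 2 * of_int n * \<i> * of_real K' | m n :: int. True}"
    and roots: "e3 < e2" "e2 < e1"
    and cubic: "\<And>x :: complex. 4 * x ^ 3 - of_real g2 * x - of_real g3
      = 4 * ((x - of_real e1) * (x - of_real e2) * (x - of_real e3))"
begin

lemma periodI: "2 * of_int m * of_real K + 2 * of_int n * \<i> * of_real K' \<in> period_lattice P"
  using lattice by blast

lemma periodic: "P (z + 2 * of_real K) = P z" "P (z + 2 * \<i> * of_real K') = P z"
  using periodI[of 1 0] periodI[of 0 1] by (simp_all add: period_lattice_def)

lemma is_poleD:
  assumes "is_pole P z"
  obtains m n :: int where "Re z = 2 * of_int m * K" "Im z = 2 * of_int n * K'"
proof -
  obtain m n :: int where "z = 2 * of_int m * of_real K + 2 * of_int n * \<i> * of_real K'"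
    using assms pole_iff_period lattice by blast
  thus thesis by (intro that[of m n]) simp_all
qed

lemma between_periods:
  fixes m :: int and x c :: real
  assumes "0 < x" "x < 2 * c"
  shows "x \<noteq> 2 * of_int m * c"
proof
  assume eq: "x = 2 * of_int m * c"
  have "0 < c" using assms by linarith
  with eq assms have "0 < real_of_int m" "real_of_int m < 1"
    by (auto simp: zero_less_mult_iff)
  thus False by simp
qed

lemma not_pole_Re: "0 < Re z \<Longrightarrow> Re z < 2 * K \<Longrightarrow> \<not> is_pole P z"
  using between_periods is_poleD by metis

lemma not_pole_Im: "0 < Im z \<Longrightarrow> Im z < 2 * K' \<Longrightarrow> \<not> is_pole P z"
  using between_periods is_poleD by metis

lemma cnj: "P (cnj z) = cnj (P z)"
  by (rule real_invariants_cnj) auto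

lemma half_period_root:
  assumes "2 * h \<in> period_lattice P" "\<not> is_pole P h"
  shows "P h \<in> {of_real e1, of_real e2, of_real e3}"
  using ode[OF assms(2)] half_period_critical[OF assms] by (auto simp: cubic)

text \<open>On each line \<open>cnj z\<close> is \<open>z\<close> or \<open>- z\<close> up to a
  period, so \<open>P z\<close> is its own conjugate. The summand \<open>0\<close> and the factor
  \<open>1\<close> match the common form \<open>h + u * x\<close> of an edge.\<close>

lemma real_on_lines:
  fixes x :: real
  shows "Im (P (0 + 1 * of_real x)) = 0" "Im (P (0 + \<i> * of_real x)) = 0"
    "Im (P (of_real K + \<i> * of_real x)) = 0" "Im (P (\<i> * of_real K' + 1 * of_real x)) = 0"
proof -
  have *: "Im (P z) = 0" if "P (cnj z) = P z" for z
    using cnj[of z] that by (metis Reals_cnj_iff complex_is_Real_iff)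
  show "Im (P (0 + 1 * of_real x)) = 0" by (rule *) simp
  show "Im (P (0 + \<i> * of_real x)) = 0"
    by (rule *) (use minus[of "\<i> * of_real x"] in simp)
  show "Im (P (of_real K + \<i> * of_real x)) = 0"
    by (rule *) (use minus[of "of_real K - \<i> * of_real x"] periodic(1)[of "\<i> * of_real x - of_real K"]
        in \<open>simp add: algebra_simps\<close>)
  show "Im (P (\<i> * of_real K' + 1 * of_real x)) = 0"
    by (rule *) (use periodic(2)[of "of_real x - \<i> * of_real K'"] in \<open>simp add: algebra_simps\<close>)
qed

text \<open>Since \<open>P\<close> is real along the line of direction \<open>u\<close>, so is the
  derivative \<open>u P'\<close> along it, and its square \<open>s (P')^2\<close> is nonnegative.
  Horizontal edges have \<open>s = 1\<close>, vertical ones \<open>s = -1\<close>.\<close>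

lemma cubic_sign_on_line:
  fixes h u :: complex and x s :: real
  assumes real: "\<And>x. Im (P (h + u * of_real x)) = 0" and u: "u\<^sup>2 = of_real s"
    and np: "\<not> is_pole P (h + u * of_real x)"
  defines "t \<equiv> Re (P (h + u * of_real x))"
  shows "s * ((t - e1) * (t - e2) * (t - e3)) \<ge> 0"
proof -
  define z where "z = h + u * of_real x"
  define D where "D = deriv P z"
  have "((\<lambda>x. h + u * of_real x) has_vector_derivative u) (at x)"
    by (auto intro!: derivative_eq_intros)
  moreover have "(P has_field_derivative D) (at (h + u * of_real x))"
    using DERIV[OF np] by (simp add: D_def z_def)
  ultimately have "((P \<circ> (\<lambda>x. h + u * of_real x)) has_vector_derivative u * D) (at x)"
    by (rule field_vector_diff_chain_at)
  hence "((\<lambda>x. Im ((P \<circ> (\<lambda>x. h + u * of_real x)) x)) has_vector_derivative Im (u * D)) (at x)"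
    by (rule bounded_linear.has_vector_derivative[OF bounded_linear_Im])
  hence "((\<lambda>x. 0) has_vector_derivative Im (u * D)) (at x)"
    by (simp add: real)
  hence Im0: "Im (u * D) = 0"
    using vector_derivative_unique_at has_vector_derivative_const by metis
  have Pz: "P z = of_real t"
    using real[of x] by (simp add: z_def t_def complex_eq_iff)
  have "(u * D)\<^sup>2 = of_real s * (4 * ((P z - of_real e1) * (P z - of_real e2) * (P z - of_real e3)))"
    using ode[OF np] u by (simp add: power_mult_distrib D_def cubic flip: z_def)
  also have "\<dots> = of_real (4 * (s * ((t - e1) * (t - e2) * (t - e3))))"
    unfolding Pz by simp
  also have "(u * D)\<^sup>2 = of_real ((Re (u * D))\<^sup>2)"
    using Im0 by (simp add: complex_eq_iff power2_eq_square)
  finally have "(Re (u * D))\<^sup>2 = 4 * (s * ((t - e1) * (t - e2) * (t - e3)))"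
    using of_real_eq_iff by blast
  thus ?thesis by (metis zero_le_power2 zero_le_mult_iff not_numeral_le_zero zero_le_numeral)
qed

lemma continuous_on_line:
  assumes "\<And>x. x \<in> S \<Longrightarrow> \<not> is_pole P (h + u * of_real x)"
  shows "continuous_on S (\<lambda>x. Re (P (h + u * of_real x)))"
proof -
  have "isCont (\<lambda>x. Re (P (h + u * of_real x))) x" if "x \<in> S" for x
  proof -
    have "isCont P (h + u * of_real x)"
      using assms[OF that] analytic_at analytic_at_imp_isCont by blast
    hence "isCont (\<lambda>x. P (h + u * of_real x)) x"
      by (intro isCont_o2[where g = P and f = "\<lambda>x. h + u * of_real x"] continuous_intros)
    thus ?thesis by (rule bounded_linear.isCont[OF bounded_linear_Re])
  qed
  thus ?thesis by (simp add: continuous_at_imp_continuous_on)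
qed

lemma large_near_0:
  assumes "c > 0" "norm u = 1"
  obtains x :: real where "0 < x" "x \<le> c" "B < norm (P (0 + u * of_real x))"
proof -
  have "\<forall>\<^sub>F z in at 0. B < norm (P z)"
    using pole_0 unfolding is_pole_def
    by (auto simp: filterlim_at_infinity_conv_norm_at_top filterlim_at_top_dense)
  then obtain d where d: "d > 0" "\<And>z. z \<noteq> 0 \<Longrightarrow> norm z < d \<Longrightarrow> B < norm (P z)"
    by (auto simp: eventually_at)
  have "B < norm (P (u * of_real (min (d / 2) c)))"
    by (rule d(2)) (use assms d in \<open>auto simp: norm_mult\<close>)
  thus thesis
    using that[of "min (d / 2) c"] d assms by simp
qed

text \<open>On the real edge \<open>P\<close> lies in the interval from \<open>e3\<close> to
  \<open>e2\<close> or above \<open>e1\<close>. The pole at \<open>0\<close> forces large values and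
  so selects the unbounded part; continuity keeps \<open>P\<close> there up to \<open>K\<close>, and
  \<open>e1\<close> is the only root in it.\<close>

lemma value_K: "P (of_real K) = of_real e1"
proof -
  define r where "r x = Re (P (0 + 1 * of_real x))" for x
  have np: "\<not> is_pole P (0 + 1 * of_real x)" if "x \<in> {0<..K}" for x :: real
    using that K by (intro not_pole_Re) auto
  have sgn: "e1 \<le> r x \<or> (e3 \<le> r x \<and> r x \<le> e2)" if "x \<in> {0<..K}" for x
    using cubic_nonnegD[OF roots] cubic_sign_on_line[OF real_on_lines(1) _ np[OF that], of 1]
    by (simp add: r_def)
  \<comment> \<open>The sum of absolute values exceeds the absolute value of every point between
    \<open>e3\<close> and \<open>e2\<close>.\<close>
  obtain x where x: "0 < x" "x \<le> K" "\<bar>e1\<bar> + \<bar>e2\<bar> + \<bar>e3\<bar> < norm (P (0 + 1 * of_real x))"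
    using large_near_0[OF K, of 1] by auto
  hence "\<bar>e1\<bar> + \<bar>e2\<bar> + \<bar>e3\<bar> < \<bar>r x\<bar>"
    using real_on_lines(1)[of x] by (simp add: r_def cmod_eq_Re)
  hence "e1 \<le> r x" using sgn[of x] x by auto
  have "e1 \<le> r K"
  proof (rule gap_upper[of "{0<..K}" r e2 e1 x K])
    show "continuous_on {0<..K} r"
      unfolding r_def by (rule continuous_on_line[OF np])
  qed (use x sgn roots K \<open>e1 \<le> r x\<close> in auto)
  moreover have "P (of_real K) \<in> {of_real e1, of_real e2, of_real e3}"
    using periodI[of 1 0] np[of K] K by (intro half_period_root) auto
  ultimately show ?thesis using roots by (auto simp: r_def)
qed

text \<open>On the imaginary axis the sign condition is reversed, so \<open>P\<close> lies below
  \<open>e3\<close> or between \<open>e2\<close> and \<open>e1\<close>; the pole selects the part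
  whose only root is \<open>e3\<close>.\<close>

lemma value_iK': "P (\<i> * of_real K') = of_real e3"
proof -
  define r where "r x = Re (P (0 + \<i> * of_real x))" for x
  have np: "\<not> is_pole P (0 + \<i> * of_real x)" if "x \<in> {0<..K'}" for x :: real
    using that K' by (intro not_pole_Im) auto
  have sgn: "r x \<le> e3 \<or> (e2 \<le> r x \<and> r x \<le> e1)" if "x \<in> {0<..K'}" for x
    using cubic_nonposD[OF roots] cubic_sign_on_line[OF real_on_lines(2) _ np[OF that], of "-1"]
    by (simp add: r_def)
  obtain x where x: "0 < x" "x \<le> K'" "\<bar>e1\<bar> + \<bar>e2\<bar> + \<bar>e3\<bar> < norm (P (0 + \<i> * of_real x))"
    using large_near_0[OF K', of \<i>] by auto
  hence "\<bar>e1\<bar> + \<bar>e2\<bar> + \<bar>e3\<bar> < \<bar>r x\<bar>"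
    using real_on_lines(2)[of x] by (simp add: r_def cmod_eq_Re)
  hence "r x \<le> e3" using sgn[of x] x by auto
  have "r K' \<le> e3"
  proof (rule gap_lower[of "{0<..K'}" r e3 e2 x K'])
    show "continuous_on {0<..K'} r"
      unfolding r_def by (rule continuous_on_line[OF np])
  qed (use x sgn roots K' \<open>r x \<le> e3\<close> in auto)
  moreover have "P (\<i> * of_real K') \<in> {of_real e1, of_real e2, of_real e3}"
    using periodI[of 0 1] np[of K'] K' by (intro half_period_root) (auto simp: mult.assoc)
  ultimately show ?thesis using roots by (auto simp: r_def)
qed

text \<open>The corner is reached along two edges. From the value \<open>e1\<close> at
  \<open>K\<close> the vertical edge keeps \<open>P\<close> at least \<open>e2\<close>; from the
  value \<open>e3\<close> at \<open>\<i> * K'\<close> the horizontal edge keeps it at most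
  \<open>e2\<close>.\<close>

lemma value_K_iK': "P (of_real K + \<i> * of_real K') = of_real e2"
proof -
  define r where "r x = Re (P (of_real K + \<i> * of_real x))" for x
  define q where "q x = Re (P (\<i> * of_real K' + 1 * of_real x))" for x
  have npr: "\<not> is_pole P (of_real K + \<i> * of_real x)" for x :: real
    using K by (intro not_pole_Re) auto
  have npq: "\<not> is_pole P (\<i> * of_real K' + 1 * of_real x)" for x :: real
    using K' by (intro not_pole_Im) auto
  have sgnr: "r x \<le> e3 \<or> (e2 \<le> r x \<and> r x \<le> e1)" for x
    using cubic_nonposD[OF roots] cubic_sign_on_line[OF real_on_lines(3) _ npr, of "-1"]
    by (simp add: r_def)
  have sgnq: "e1 \<le> q x \<or> (e3 \<le> q x \<and> q x \<le> e2)" for x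
    using cubic_nonnegD[OF roots] cubic_sign_on_line[OF real_on_lines(4) _ npq, of 1]
    by (simp add: q_def)
  have "e2 \<le> r K'"
  proof (rule gap_upper[of UNIV r e3 e2 0 K'])
    show "continuous_on UNIV r"
      unfolding r_def by (rule continuous_on_line[OF npr])
  qed (use sgnr roots value_K in \<open>auto simp: r_def\<close>)
  moreover have "q K \<le> e2"
  proof (rule gap_lower[of UNIV q e2 e1 0 K])
    show "continuous_on UNIV q"
      unfolding q_def by (rule continuous_on_line[OF npq])
  qed (use sgnq roots value_iK' in \<open>auto simp: q_def\<close>)
  moreover have "P (of_real K + \<i> * of_real K') \<in> {of_real e1, of_real e2, of_real e3}"
    using periodI[of 1 1] npr[of K'] by (intro half_period_root) (auto simp: algebra_simps)
  ultimately show ?thesis using roots by (auto simp: r_def q_def add.commute)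
qed

end

subsection \<open>The hypergeometric function\<close>

abbreviation hyp3 :: "complex fps" where
  "hyp3 \<equiv> fps_hypergeo [1/3, 2/3] [1/2] 1"

section \<open>Coefficients, convergence and differential equation of F(1/3,2/3;1/2;z)\<close>

lemma hyp3_Suc:
  "hyp3 $ Suc n = (1/3 + of_nat n) * (2/3 + of_nat n) / (of_nat (Suc n) * (1/2 + of_nat n)) * hyp3 $ n"
  unfolding fps_hypergeo_rec by (simp del: fps_hypergeo_nth of_nat_Suc)

lemma half_add_of_nat_nonzero: "1/2 + of_nat n \<noteq> (0 :: complex)"
proof
  assume "1/2 + of_nat n = (0 :: complex)"
  hence "Re (1/2 + of_nat n) = 0" by simp
  thus False by simp
qed

lemma hyp3_rec:
  "of_nat (n + 1) * (of_nat n + 1/2) * hyp3 $ (n + 1) = (of_nat n ^ 2 + of_nat n + 2/9) * hyp3 $ n"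
proof -
  define D :: complex where "D = of_nat (Suc n) * (1/2 + of_nat n)"
  have "D \<noteq> 0"
    unfolding D_def using half_add_of_nat_nonzero[of n] of_nat_neq_0[of n, where 'a = complex]
    by (simp only: mult_eq_0_iff simp_thms)
  hence "D * hyp3 $ Suc n = (1/3 + of_nat n) * (2/3 + of_nat n) * hyp3 $ n"
    unfolding hyp3_Suc D_def[symmetric] by (simp del: fps_hypergeo_nth)
  thus ?thesis
    unfolding D_def Suc_eq_plus1 by (simp del: fps_hypergeo_nth of_nat_add of_nat_Suc add: algebra_simps power2_eq_square)
qed

text \<open>Consecutive coefficients have a ratio of at most 1, because
  \<open>n^2 + n + 2/9 \<le> (n + 1) (n + 1/2)\<close>. This crude bound suffices for convergence in
  the unit disc.\<close>

lemma norm_hyp3_le: "norm (hyp3 $ n) \<le> 1"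
proof (induction n)
  case (Suc n)
  define q where "q = (1/3 + real n) * (2/3 + real n) / (real (Suc n) * (1/2 + real n))"
  have eq: "hyp3 $ Suc n = of_real q * hyp3 $ n"
    unfolding hyp3_Suc q_def by (simp del: fps_hypergeo_nth of_nat_Suc)
  have q: "0 \<le> q" "q \<le> 1"
    unfolding q_def by (simp_all add: divide_simps) (simp_all add: algebra_simps)
  have "norm (hyp3 $ Suc n) = q * norm (hyp3 $ n)"
    unfolding eq norm_mult norm_of_real using q(1) by (simp only: abs_of_nonneg)
  also have "\<dots> \<le> 1 * 1"
    using Suc q by (intro mult_mono) (simp_all del: fps_hypergeo_nth)
  finally show ?case by simp
qed simp

lemma hyp3_conv_radius: "fps_conv_radius hyp3 \<ge> 1"
  unfolding fps_conv_radius_def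
proof (rule conv_radius_geI_ex')
  fix r :: real assume r: "0 < r" "ereal r < 1"
  show "summable (\<lambda>n. hyp3 $ n * of_real r ^ n)"
  proof (rule summable_comparison_test)
    show "\<exists>N. \<forall>n\<ge>N. norm (hyp3 $ n * of_real r ^ n) \<le> r ^ n"
      using r norm_hyp3_le by (auto simp del: fps_hypergeo_nth simp: norm_mult norm_power intro!: mult_left_le_one_le)
    show "summable (\<lambda>n. r ^ n)" using r by (intro summable_geometric) (auto simp: one_ereal_def)
  qed
qed

lemma hyp3_deriv:
  assumes "norm z < 1"
  shows "(eval_fps hyp3 has_field_derivative eval_fps (fps_deriv hyp3) z) (at z)"
    and "(eval_fps (fps_deriv hyp3) has_field_derivative eval_fps (fps_deriv (fps_deriv hyp3)) z) (at z)"
proof -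
  have "ereal (norm z) < 1" using assms by (simp add: one_ereal_def)
  hence *: "ereal (norm z) < fps_conv_radius hyp3" "ereal (norm z) < fps_conv_radius (fps_deriv hyp3)"
    using hyp3_conv_radius fps_conv_radius_deriv[of hyp3] by (meson less_le_trans)+
  show "(eval_fps hyp3 has_field_derivative eval_fps (fps_deriv hyp3) z) (at z)"
    by (rule has_field_derivative_eval_fps[OF *(1)])
  show "(eval_fps (fps_deriv hyp3) has_field_derivative eval_fps (fps_deriv (fps_deriv hyp3)) z) (at z)"
    by (rule has_field_derivative_eval_fps[OF *(2)])
qed

text \<open>This is the Gauss equation for \<open>a = 1/3\<close>, \<open>b = 2/3\<close>,
  \<open>c = 1/2\<close>, where \<open>a + b + 1 = 2\<close> and \<open>a b = 2/9\<close>. Comparing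
  coefficients reduces it to the recurrence \<open>hyp3_rec\<close>.\<close>

lemma hyp3_ode:
  assumes "norm z < 1"
  shows "z * (1 - z) * eval_fps (fps_deriv (fps_deriv hyp3)) z + (1/2 - 2 * z) * eval_fps (fps_deriv hyp3) z
       = 2/9 * eval_fps hyp3 z"
proof -
  let ?F = hyp3 and ?F' = "fps_deriv hyp3" and ?F'' = "fps_deriv (fps_deriv hyp3)"
  have z: "ereal (norm z) < 1" using assms by (simp add: one_ereal_def)
  have sums: "(\<lambda>n. G $ n * z ^ n) sums eval_fps G z" if "fps_conv_radius G \<ge> 1" for G
    by (rule sums_eval_fps) (use z that in \<open>meson less_le_trans\<close>)
  have R: "fps_conv_radius ?F \<ge> 1" "fps_conv_radius ?F' \<ge> 1" "fps_conv_radius ?F'' \<ge> 1"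
    using hyp3_conv_radius fps_conv_radius_deriv[of ?F] fps_conv_radius_deriv[of ?F'] by (meson order_trans)+
  have X: "fps_conv_radius (fps_X * G) \<ge> 1" "eval_fps (fps_X * G) z = z * eval_fps G z"
    if "fps_conv_radius G \<ge> 1" for G :: "complex fps"
  proof -
    show "fps_conv_radius (fps_X * G) \<ge> 1"
      using fps_conv_radius_mult[of "fps_X" G] that by (simp add: order_trans)
    show "eval_fps (fps_X * G) z = z * eval_fps G z"
      using less_le_trans[OF z that] by (subst eval_fps_mult) simp_all
  qed
  have "(\<lambda>n. (fps_X * ?F'') $ n * z ^ n - (fps_X * (fps_X * ?F'')) $ n * z ^ n
      + (1/2 * (?F' $ n * z ^ n) - 2 * ((fps_X * ?F') $ n * z ^ n)) - 2/9 * (?F $ n * z ^ n)) sums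
      (z * eval_fps ?F'' z - z * (z * eval_fps ?F'' z)
        + (1/2 * eval_fps ?F' z - 2 * (z * eval_fps ?F' z)) - 2/9 * eval_fps ?F z)"
    using sums[OF X(1)[OF R(3)]] sums[OF X(1)[OF X(1)[OF R(3)]]] sums[OF R(2)] sums[OF X(1)[OF R(2)]] sums[OF R(1)]
    unfolding X(2)[OF R(3)] X(2)[OF X(1)[OF R(3)]] X(2)[OF R(2)]
    by (intro sums_diff sums_add sums_mult)
  moreover have "(fps_X * ?F'') $ n * z ^ n - (fps_X * (fps_X * ?F'')) $ n * z ^ n
      + (1/2 * (?F' $ n * z ^ n) - 2 * ((fps_X * ?F') $ n * z ^ n)) - 2/9 * (?F $ n * z ^ n) = 0" for n
  proof -
    \<comment> \<open>In this formula and the next ones the factors \<open>of_nat n\<close> and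
      \<open>of_nat n - 1\<close> vanish exactly where a shift by \<open>fps_X\<close> leaves no
      coefficient.\<close>
    have 1: "(fps_X * ?F'') $ n = of_nat n * of_nat (n + 1) * ?F $ (n + 1)"
      by (cases n) (simp_all del: fps_hypergeo_nth add: algebra_simps)
    have 2: "(fps_X * (fps_X * ?F'')) $ n = of_nat n * (of_nat n - 1) * ?F $ n"
    proof (cases n)
      case (Suc m)
      thus ?thesis by (cases m) (simp_all del: fps_hypergeo_nth add: algebra_simps)
    qed (simp del: fps_hypergeo_nth)
    have 3: "?F' $ n = of_nat (n + 1) * ?F $ (n + 1)" by (simp del: fps_hypergeo_nth)
    have 4: "(fps_X * ?F') $ n = of_nat n * ?F $ n"
      by (cases n) (simp_all del: fps_hypergeo_nth)
    have "(fps_X * ?F'') $ n - (fps_X * (fps_X * ?F'')) $ n + (1/2 * ?F' $ n - 2 * (fps_X * ?F') $ n) - 2/9 * ?F $ n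
        = of_nat (n + 1) * (of_nat n + 1/2) * ?F $ (n + 1) - (of_nat n ^ 2 + of_nat n + 2/9) * ?F $ n"
      unfolding 1 2 3 4 by (simp del: fps_hypergeo_nth of_nat_Suc of_nat_add add: algebra_simps power2_eq_square)
    also have "\<dots> = 0" unfolding hyp3_rec by simp
    finally have "((fps_X * ?F'') $ n - (fps_X * (fps_X * ?F'')) $ n + (1/2 * ?F' $ n - 2 * (fps_X * ?F') $ n)
        - 2/9 * ?F $ n) * z ^ n = 0" by simp
    thus ?thesis by (simp only: left_diff_distrib distrib_right mult.assoc)
  qed
  ultimately have "(\<lambda>n. 0) sums (z * eval_fps ?F'' z - z * (z * eval_fps ?F'' z)
        + (1/2 * eval_fps ?F' z - 2 * (z * eval_fps ?F' z)) - 2/9 * eval_fps ?F z)"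
    by (simp only:)
  from sums_unique2[OF sums_zero this]
  have "z * eval_fps ?F'' z - z * (z * eval_fps ?F'' z)
        + (1/2 * eval_fps ?F' z - 2 * (z * eval_fps ?F' z)) - 2/9 * eval_fps ?F z = 0" by (rule sym)
  thus ?thesis by (simp del: fps_hypergeo_nth add: algebra_simps)
qed

text \<open>Under \<open>z = sin^2 s\<close> the Gauss equation becomes \<open>y'' = - y / 9\<close>
  for \<open>y = F cos s\<close>, with \<open>y(0) = 1\<close> and \<open>y'(0) = 0\<close>; the
  function \<open>cos (s / 3)\<close> solves the same problem.\<close>

lemma gauss_hypergeo_third_sin:
  "\<forall>\<^sub>F s in nhds 0. gauss_hypergeo (1/3) (2/3) (1/2) ((sin s)\<^sup>2) * cos s = cos (s / 3)"
proof -
  let ?F = "eval_fps hyp3" and ?F' = "eval_fps (fps_deriv hyp3)" and ?F'' = "eval_fps (fps_deriv (fps_deriv hyp3))"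
  define U where "U = {s :: complex. norm (sin s) < 1}"
  have U: "open U" "0 \<in> U"
    unfolding U_def by (auto intro!: open_Collect_less continuous_intros)
  define y where "y s = ?F ((sin s)\<^sup>2) * cos s" for s
  define y' where "y' s = ?F' ((sin s)\<^sup>2) * (2 * sin s * (cos s)\<^sup>2) - ?F ((sin s)\<^sup>2) * sin s" for s
  have small: "norm ((sin s)\<^sup>2) < 1" if "s \<in> U" for s
    using that by (auto simp: U_def norm_power intro: power_less_one_iff[THEN iffD2])
  have sin2: "((\<lambda>s. (sin s)\<^sup>2) has_field_derivative 2 * sin s * cos s) (at s)" for s :: complex
    by (auto intro!: derivative_eq_intros)
  note chain = DERIV_chain2[where g = "\<lambda>s. (sin s)\<^sup>2", OF _ sin2]
  have y: "(y has_field_derivative y' s) (at s)" if "s \<in> U" for s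
  proof -
    note [derivative_intros] = chain[OF hyp3_deriv(1)[OF small[OF that]]]
    show ?thesis unfolding y_def y'_def
      by (rule derivative_eq_intros refl)+ (simp add: power2_eq_square algebra_simps)
  qed
  have y': "(y' has_field_derivative - (1/9) * y s) (at s)" if "s \<in> U" for s
  proof -
    note [derivative_intros] = chain[OF hyp3_deriv(1)[OF small[OF that]]]
      chain[OF hyp3_deriv(2)[OF small[OF that]]]
    define x where "x = (sin s)\<^sup>2"
    define A where "A = ?F x"
    define B where "B = ?F' x"
    define C where "C = ?F'' x"
    note x_A_B_C_def = x_def A_def B_def C_def
    have ode: "x * (1 - x) * C + (1/2 - 2 * x) * B = 2/9 * A"
      using hyp3_ode[OF small[OF that]] by (simp add: x_A_B_C_def)
    have cx: "(cos s)\<^sup>2 = 1 - x" by (simp add: x_A_B_C_def cos_squared_eq)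
    have "(y' has_field_derivative
        C * (2 * sin s * cos s) * (2 * sin s * (cos s)\<^sup>2) + (2 * cos s * (cos s)\<^sup>2 - 4 * (sin s)\<^sup>2 * cos s) * B
        - (B * (2 * sin s * cos s) * sin s + cos s * A)) (at s)"
      unfolding y'_def x_A_B_C_def
      by (rule derivative_eq_intros refl)+ (simp add: power2_eq_square algebra_simps)
    moreover have "C * (2 * sin s * cos s) * (2 * sin s * (cos s)\<^sup>2) + (2 * cos s * (cos s)\<^sup>2 - 4 * (sin s)\<^sup>2 * cos s) * B
        - (B * (2 * sin s * cos s) * sin s + cos s * A) = - (1/9) * (A * cos s)"
    proof -
      have "C * (2 * sin s * cos s) * (2 * sin s * (cos s)\<^sup>2) + (2 * cos s * (cos s)\<^sup>2 - 4 * (sin s)\<^sup>2 * cos s) * B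
        - (B * (2 * sin s * cos s) * sin s + cos s * A)
        = cos s * (4 * (x * (cos s)\<^sup>2 * C) + 2 * (cos s)\<^sup>2 * B - 6 * x * B - A)"
        by (simp add: x_A_B_C_def(1) power2_eq_square algebra_simps)
      \<comment> \<open>Four times the left side of the Gauss equation appears, and
        \<open>4 * 2/9 - 1 = - 1/9\<close>.\<close>
      also have "\<dots> = cos s * (4 * (x * (1 - x) * C + (1/2 - 2 * x) * B) - A)"
        unfolding cx by (simp add: algebra_simps)
      also have "\<dots> = - (1/9) * (A * cos s)" unfolding ode by simp
      finally show ?thesis .
    qed
    ultimately show ?thesis by (simp add: y_def x_A_B_C_def)
  qed
  have evU: "\<forall>\<^sub>F s in nhds 0. s \<in> U" using U by (rule eventually_nhds_in_open)
  have dy: "deriv y s = y' s" if "s \<in> U" for s using y[OF that] by (rule DERIV_imp_deriv)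
  have ddy: "deriv (deriv y) s = - (1/9) * y s" if "s \<in> U" for s
  proof -
    have "\<forall>\<^sub>F w in nhds s. deriv y w = y' w"
      using eventually_nhds_in_open[OF U(1) that] by eventually_elim (rule dy)
    from DERIV_eventually_eqI[OF y'[OF that] this] show ?thesis by (rule DERIV_imp_deriv)
  qed
  have "\<forall>\<^sub>F s in nhds 0. y s = cos (s / 3)"
  proof (rule analytic_second_order_ode_unique[where p = "[:0, - (1/9):]"])
    have "y holomorphic_on U"
      using y U holomorphic_on_open by blast
    thus "y analytic_on {0}" using U analytic_at by blast
    show "(\<lambda>s. cos (s / 3)) analytic_on {0 :: complex}"
      by (auto intro!: analytic_intros)
    have c1: "((\<lambda>s. cos (s / 3)) has_field_derivative - sin (s / 3) / 3) (at s)" for s :: complex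
      by (auto intro!: derivative_eq_intros)
    have c2: "((\<lambda>s. - sin (s / 3) / 3) has_field_derivative - (1/9) * cos (s / 3)) (at s)" for s :: complex
      by (auto intro!: derivative_eq_intros)
    have c1': "deriv (\<lambda>s. cos (s / 3)) = (\<lambda>s :: complex. - sin (s / 3) / 3)"
      using DERIV_imp_deriv[OF c1] by blast
    show "y 0 = cos (0 / 3)" by (simp add: y_def eval_fps_at_0)
    show "deriv y 0 = deriv (\<lambda>s. cos (s / 3)) 0" using U by (simp add: dy c1' y'_def)
    show "\<forall>\<^sub>F s in nhds 0. deriv (deriv y) s = poly [:0, - (1/9):] (y s)"
      using evU by eventually_elim (simp add: ddy)
    show "\<forall>\<^sub>F s in nhds 0. deriv (deriv (\<lambda>s. cos (s / 3))) s = poly [:0, - (1/9):] (cos (s / 3) :: complex)"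
      unfolding c1' using DERIV_imp_deriv[OF c2] by simp
  qed
  thus ?thesis by (simp add: y_def gauss_hypergeo_def)
qed

text \<open>On a small disc the argument of the series stays in the unit disc, so the integrand is
  holomorphic and has a primitive there; the segment from \<open>0\<close> to \<open>T\<close>
  remains in the disc.\<close>

lemma hypergeo_integral_deriv:
  assumes "\<bar>\<kappa>\<bar> < 1"
  shows "\<forall>\<^sub>F T in nhds 0. (hypergeo_integral \<kappa> has_field_derivative
    gauss_hypergeo (1/3) (2/3) (1/2) ((of_real \<kappa> * sin T)\<^sup>2)) (at T)"
proof -
  let ?h = "\<lambda>t. gauss_hypergeo (1/3) (2/3) (1/2) ((of_real \<kappa>)\<^sup>2 * (sin t)\<^sup>2)"
  define U where "U = {s :: complex. norm (sin s) < 1}"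
  have "open U" "0 \<in> U"
    unfolding U_def by (auto intro!: open_Collect_less continuous_intros)
  then obtain r where r: "r > 0" "ball 0 r \<subseteq> U" by (meson openE)
  have hol: "?h holomorphic_on ball 0 r"
  proof -
    have "(eval_fps hyp3 \<circ> (\<lambda>t. (of_real \<kappa>)\<^sup>2 * (sin t)\<^sup>2)) holomorphic_on ball 0 r"
    proof (rule holomorphic_on_compose_gen)
      show "(\<lambda>t. (of_real \<kappa>)\<^sup>2 * (sin t)\<^sup>2) holomorphic_on ball 0 r"
        by (intro holomorphic_intros)
      show "eval_fps hyp3 holomorphic_on ball 0 1"
        unfolding holomorphic_on_open[OF open_ball]
      proof
        fix x :: complex assume "x \<in> ball 0 1"
        thus "\<exists>f'. (eval_fps hyp3 has_field_derivative f') (at x)" using hyp3_deriv(1)[of x] by auto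
      qed
      show "(\<lambda>t. (complex_of_real \<kappa>)\<^sup>2 * (sin t)\<^sup>2) ` ball 0 r \<subseteq> ball 0 1"
      proof clarsimp
        fix t :: complex assume "norm t < r"
        hence "norm (sin t) < 1" using r by (auto simp: U_def)
        hence "norm (of_real \<kappa> * sin t) < 1"
          using assms mult_strict_mono'[of "\<bar>\<kappa>\<bar>" 1 "norm (sin t)" 1] by (simp add: norm_mult)
        hence "norm ((of_real \<kappa> * sin t)\<^sup>2) < 1"
          by (simp add: norm_power power_less_one_iff)
        thus "norm ((of_real \<kappa>)\<^sup>2 * (sin t)\<^sup>2) < 1" by (simp add: power_mult_distrib)
      qed
    qed
    thus ?thesis by (simp add: o_def gauss_hypergeo_def)
  qed
  obtain g where g: "\<And>x. x \<in> ball 0 r \<Longrightarrow> (g has_field_derivative ?h x) (at x within ball 0 r)"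
    using holomorphic_convex_primitive'[OF convex_ball open_ball hol] by blast
  have eq: "hypergeo_integral \<kappa> T = g T - g 0" if "T \<in> ball 0 r" for T
  proof -
    have "path_image (linepath 0 T) \<subseteq> ball 0 r"
      using that r by (auto simp: closed_segment_subset)
    hence "(?h has_contour_integral (g (pathfinish (linepath 0 T)) - g (pathstart (linepath 0 T)))) (linepath 0 T)"
      by (intro contour_integral_primitive[OF g]) auto
    thus ?thesis
      unfolding hypergeo_integral_def by (simp add: contour_integral_unique)
  qed
  have "\<forall>\<^sub>F T in nhds 0. T \<in> ball 0 r" using r by (intro eventually_nhds_in_open) auto
  thus ?thesis
  proof eventually_elim
    case (elim T)
    have "(g has_field_derivative ?h T) (at T)"
      using g[OF elim] at_within_open[OF elim] by simp
    hence "((\<lambda>T. g T - g 0) has_field_derivative ?h T) (at T)"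
      by (auto intro!: derivative_eq_intros)
    moreover have "\<forall>\<^sub>F T in nhds T. hypergeo_integral \<kappa> T = g T - g 0"
      using eventually_nhds_in_open[OF open_ball elim] by eventually_elim (rule eq)
    ultimately have "(hypergeo_integral \<kappa> has_field_derivative ?h T) (at T)"
      by (rule DERIV_eventually_eqI)
    thus ?case by (simp add: power_mult_distrib)
  qed
qed

text \<open>Half the derivative of \<open>4/9 (1 - d) (d^3 + 3 d^2 - 4 (1 - \<kappa>^2))\<close>,
  the quartic that equals \<open>(d')^2\<close> for \<open>d = dn3\<close>.\<close>

definition dn3_ode_poly :: "real \<Rightarrow> complex poly" where
  "dn3_ode_poly \<kappa> = [:8/9 * (1 - (of_real \<kappa>)\<^sup>2), 4/3, - 4/3, - 8/9:]"

text \<open>With \<open>sin s = \<kappa> sin \<phi>\<close> the hypergeometric factor becomes \<open>cos (s/3) / cos s\<close>, so that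
  \<open>\<phi>' = cos s / cos (s/3) = 4 cos\<^sup>2 (s/3) - 3\<close>.\<close>

lemma deriv_local_inverse_ode:
  assumes \<kappa>: "\<bar>\<kappa>\<bar> < 1" and \<phi>: "analytic_local_inverse_at_0 (hypergeo_integral \<kappa>) \<phi>"
  obtains d where "\<forall>\<^sub>F z in nhds 0. deriv \<phi> z = d z" "d analytic_on {0}" "d 0 = 1" "deriv d 0 = 0"
    "\<forall>\<^sub>F z in nhds 0. deriv (deriv d) z = poly (dn3_ode_poly \<kappa>) (d z)"
proof -
  let ?h = "\<lambda>t. gauss_hypergeo (1/3) (2/3) (1/2) ((of_real \<kappa> * sin t)\<^sup>2)"
  \<comment> \<open>\<open>Arcsin\<close> is the branch that vanishes at \<open>0\<close> and is
    analytic there, so \<open>s\<close> tends to \<open>0\<close> with \<open>z\<close>.\<close>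
  define s where "s z = Arcsin (of_real \<kappa> * sin (\<phi> z))" for z
  define d where "d z = 4 * (cos (s z / 3))\<^sup>2 - 3" for z
  have an: "\<phi> analytic_on {0}" and \<phi>0: "\<phi> 0 = 0"
    and inv: "\<forall>\<^sub>F z in nhds 0. hypergeo_integral \<kappa> (\<phi> z) = z"
    using \<phi> by (auto simp: analytic_local_inverse_at_0_def)
  have lim\<phi>: "(\<phi> \<longlongrightarrow> 0) (nhds 0)"
    using analytic_at_imp_isCont[OF an] \<phi>0 by (simp add: isCont_def tendsto_nhds_iff)
  have lim: "((\<lambda>z. of_real \<kappa> * sin (\<phi> z)) \<longlongrightarrow> 0) (nhds 0)"
    using tendsto_mult_right_zero[OF tendsto_sin[OF lim\<phi>, simplified]] by simp
  have lims: "(s \<longlongrightarrow> 0) (nhds 0)"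
  proof -
    have "isCont Arcsin (0 :: complex)"
      using field_differentiable_at_Arcsin[of 0] field_differentiable_imp_continuous_at by force
    from isCont_tendsto_compose[OF this lim] show ?thesis by (simp add: s_def [abs_def])
  qed
  have e1: "\<forall>\<^sub>F z in nhds 0. \<phi> analytic_on {z}"
    by (rule eventually_analytic_at[OF an])
  have e2: "\<forall>\<^sub>F z in nhds 0. norm (of_real \<kappa> * sin (\<phi> z)) < 1"
    using order_tendstoD(2)[OF tendsto_norm[OF lim], of 1] by simp
  have e3: "\<forall>\<^sub>F z in nhds 0. cos (s z) \<noteq> 0"
    using tendsto_imp_eventually_ne[OF tendsto_cos[OF lims], of 0] by simp
  have e4: "\<forall>\<^sub>F z in nhds 0. cos (s z / 3) \<noteq> 0"
    using tendsto_imp_eventually_ne[OF tendsto_cos[OF tendsto_divide[OF lims tendsto_const[of 3]]], of 0] by simp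
  have e5: "\<forall>\<^sub>F z in nhds 0. (hypergeo_integral \<kappa> has_field_derivative ?h (\<phi> z)) (at (\<phi> z))"
    using eventually_compose_filterlim[OF hypergeo_integral_deriv[OF \<kappa>] lim\<phi>] .
  have e6: "\<forall>\<^sub>F z in nhds 0. gauss_hypergeo (1/3) (2/3) (1/2) ((sin (s z))\<^sup>2) * cos (s z) = cos (s z / 3)"
    using eventually_compose_filterlim[OF gauss_hypergeo_third_sin lims] .
  \<comment> \<open>To differentiate the inverse relation at \<open>z\<close>, it must hold on a
    neighbourhood of \<open>z\<close>.\<close>
  have e7: "\<forall>\<^sub>F z in nhds 0. \<forall>\<^sub>F w in nhds z. hypergeo_integral \<kappa> (\<phi> w) = w"
    using inv by (simp add: eventually_eventually)
  have "\<forall>\<^sub>F z in nhds 0. \<phi> analytic_on {z} \<and> norm (of_real \<kappa> * sin (\<phi> z)) < 1 \<and> cos (s z) \<noteq> 0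
      \<and> cos (s z / 3) \<noteq> 0 \<and> deriv \<phi> z = d z"
    using e1 e2 e3 e4 e5 e6 e7
  proof eventually_elim
    case (elim z)
    have "(\<phi> has_field_derivative deriv \<phi> z) (at z)"
      using elim(1) analytic_on_imp_differentiable_at DERIV_deriv_iff_field_differentiable by blast
    from DERIV_chain2[OF elim(5) this]
    have "((\<lambda>z. hypergeo_integral \<kappa> (\<phi> z)) has_field_derivative ?h (\<phi> z) * deriv \<phi> z) (at z)" .
    moreover have "((\<lambda>z. hypergeo_integral \<kappa> (\<phi> z)) has_field_derivative 1) (at z)"
      by (rule DERIV_eventually_eqI[OF DERIV_ident elim(7)])
    ultimately have 1: "?h (\<phi> z) * deriv \<phi> z = 1" by (rule DERIV_unique)
    have "sin (s z) = of_real \<kappa> * sin (\<phi> z)" by (simp add: s_def)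
    hence "?h (\<phi> z) * cos (s z) = cos (s z / 3)" using elim(6) by simp
    hence "cos (s z / 3) * deriv \<phi> z = (?h (\<phi> z) * deriv \<phi> z) * cos (s z)" by simp
    hence "cos (s z / 3) * deriv \<phi> z = cos (s z)" unfolding 1 by simp
    also have "\<dots> = 4 * cos (s z / 3) ^ 3 - 3 * cos (s z / 3)"
      using cos_treble_cos[of "s z / 3"] by simp
    also have "\<dots> = cos (s z / 3) * d z"
      by (simp add: d_def power2_eq_square power3_eq_cube algebra_simps)
    finally have "deriv \<phi> z = d z" using elim(4) by simp
    thus ?case using elim by simp
  qed
  then obtain N where N: "open N" "0 \<in> N" and N': "\<And>z. z \<in> N \<Longrightarrow> \<phi> analytic_on {z}
      \<and> norm (of_real \<kappa> * sin (\<phi> z)) < 1 \<and> cos (s z) \<noteq> 0 \<and> cos (s z / 3) \<noteq> 0 \<and> deriv \<phi> z = d z"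
    unfolding eventually_nhds by blast
  have sin_s: "sin (s z) = of_real \<kappa> * sin (\<phi> z)" for z by (simp add: s_def)
  have cos_s: "cos (s z) = cos (s z / 3) * d z" for z
    using cos_treble_cos[of "s z / 3"] by (simp add: d_def power2_eq_square power3_eq_cube algebra_simps)
  have \<phi>': "(\<phi> has_field_derivative d z) (at z)" if "z \<in> N" for z
    using N'[OF that] analytic_on_imp_differentiable_at[of \<phi> "{z}" z] DERIV_deriv_iff_field_differentiable[of \<phi> z] by simp
  \<comment> \<open>The chain rule gives \<open>\<kappa> cos \<phi> \<phi>' / cos s\<close>, and
    \<open>\<phi>' = cos s / cos (s/3)\<close> cancels \<open>cos s\<close>.\<close>
  have s': "(s has_field_derivative of_real \<kappa> * cos (\<phi> z) / cos (s z / 3)) (at z)" if z: "z \<in> N" for z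
  proof -
    have "\<bar>Re (of_real \<kappa> * sin (\<phi> z))\<bar> < 1"
      using N'[OF z] abs_Re_le_cmod le_less_trans by blast
    hence "(Arcsin has_field_derivative inverse (cos (s z))) (at (of_real \<kappa> * sin (\<phi> z)))"
      unfolding s_def by (intro has_field_derivative_Arcsin)
    moreover have "((\<lambda>z. of_real \<kappa> * sin (\<phi> z)) has_field_derivative of_real \<kappa> * (cos (\<phi> z) * d z)) (at z)"
      using \<phi>'[OF z] by (auto intro!: derivative_eq_intros)
    ultimately have "(s has_field_derivative inverse (cos (s z)) * (of_real \<kappa> * (cos (\<phi> z) * d z))) (at z)"
      unfolding s_def by (rule DERIV_chain2)
    moreover have "d z \<noteq> 0" using N'[OF z] cos_s[of z] by auto
    hence "inverse (cos (s z)) * (of_real \<kappa> * (cos (\<phi> z) * d z)) = of_real \<kappa> * cos (\<phi> z) / cos (s z / 3)"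
      unfolding cos_s by (simp add: field_simps)
    ultimately show ?thesis by simp
  qed
  define d' where "d' z = - (8/3) * (sin (s z / 3) * (of_real \<kappa> * cos (\<phi> z)))" for z
  have dd: "(d has_field_derivative d' z) (at z)" if z: "z \<in> N" for z
  proof -
    have "(d has_field_derivative 4 * (2 * cos (s z / 3) * (- sin (s z / 3) * ((of_real \<kappa> * cos (\<phi> z) / cos (s z / 3)) / 3)))) (at z)"
      unfolding d_def [abs_def]
      by (rule derivative_eq_intros s'[OF z] refl | simp)+
    moreover have "4 * (2 * cos (s z / 3) * (- sin (s z / 3) * ((of_real \<kappa> * cos (\<phi> z) / cos (s z / 3)) / 3))) = d' z"
      using N'[OF z] by (simp add: d'_def)
    ultimately show ?thesis by simp
  qed
  have dd': "(d' has_field_derivative poly (dn3_ode_poly \<kappa>) (d z)) (at z)" if z: "z \<in> N" for z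
  proof -
    define S where "S = sin (s z / 3)"
    define C where "C = cos (s z / 3)"
    define X where "X = of_real \<kappa> * cos (\<phi> z)"
    define Y where "Y = of_real \<kappa> * sin (\<phi> z)"
    have C0: "C \<noteq> 0" using N'[OF z] by (simp add: C_def)
    have "(d' has_field_derivative - (8/3) * (C * ((X / C) / 3) * X + S * (of_real \<kappa> * (- sin (\<phi> z) * d z)))) (at z)"
      unfolding d'_def [abs_def] S_def C_def X_def
      by (rule derivative_eq_intros s'[OF z] \<phi>'[OF z] refl | simp)+
    also have "- (8/3) * (C * ((X / C) / 3) * X + S * (of_real \<kappa> * (- sin (\<phi> z) * d z)))
        = - (8/3) * (X\<^sup>2 / 3 - S * Y * d z)"
      using C0 by (simp add: Y_def power2_eq_square algebra_simps)
    \<comment> \<open>Everything is expressed through \<open>C\<close>: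
      \<open>d = 4 C^2 - 3\<close>, \<open>Y = sin s = S (4 C^2 - 1)\<close> by the triple angle
      formula, and \<open>X^2 + Y^2 = \<kappa>^2\<close>.\<close>
    also have "\<dots> = poly (dn3_ode_poly \<kappa>) (d z)"
    proof -
      have dC: "d z = 4 * C\<^sup>2 - 3" by (simp add: d_def C_def)
      have S2: "S\<^sup>2 = 1 - C\<^sup>2" by (simp add: S_def C_def sin_squared_eq)
      have Y3: "Y = S * (4 * C\<^sup>2 - 1)"
      proof -
        have "Y = sin (3 * (s z / 3))" using sin_s[of z] by (simp add: Y_def)
        also have "\<dots> = sin (2 * (s z / 3) + s z / 3)" by (rule arg_cong[where f = sin]) simp
        also have "\<dots> = 2 * S * C * C + (2 * C\<^sup>2 - 1) * S"
          unfolding sin_add sin_double cos_double_cos by (simp add: S_def C_def)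
        finally show ?thesis by (simp add: power2_eq_square algebra_simps)
      qed
      have X2: "X\<^sup>2 = (of_real \<kappa>)\<^sup>2 - Y\<^sup>2"
        by (simp add: X_def Y_def power_mult_distrib cos_squared_eq algebra_simps)
      have YY: "Y\<^sup>2 = (1 - C\<^sup>2) * (4 * C\<^sup>2 - 1)\<^sup>2" unfolding Y3 power_mult_distrib S2 ..
      have SY: "S * Y = (1 - C\<^sup>2) * (4 * C\<^sup>2 - 1)" unfolding Y3 S2[symmetric] by (simp add: power2_eq_square)
      show ?thesis unfolding X2 YY SY dC dn3_ode_poly_def
        by (simp add: power2_eq_square field_simps)
    qed
    finally show ?thesis .
  qed
  show thesis
  proof (rule that)
    have evN: "\<forall>\<^sub>F z in nhds 0. z \<in> N" using N by (rule eventually_nhds_in_open)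
    show "\<forall>\<^sub>F z in nhds 0. deriv \<phi> z = d z" using evN by eventually_elim (use N' in blast)
    have "d holomorphic_on N" using dd N holomorphic_on_open by blast
    thus "d analytic_on {0}" using N analytic_at by blast
    have s0: "s 0 = 0" by (simp add: s_def \<phi>0)
    show "d 0 = 1" by (simp add: d_def s0)
    show "deriv d 0 = 0" using DERIV_imp_deriv[OF dd[OF N(2)]] by (simp add: d'_def s0)
    show "\<forall>\<^sub>F z in nhds 0. deriv (deriv d) z = poly (dn3_ode_poly \<kappa>) (d z)"
      using evN
    proof eventually_elim
      case (elim z)
      have "\<forall>\<^sub>F w in nhds z. deriv d w = d' w"
        using eventually_nhds_in_open[OF N(1) elim] by eventually_elim (rule DERIV_imp_deriv[OF dd])
      from DERIV_imp_deriv[OF DERIV_eventually_eqI[OF dd'[OF elim] this]] show ?case .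
    qed
  qed
qed

subsection \<open>The cubic and the identification of the elliptic function\<close>

lemma cubic_difference:
  fixes x y c :: "'a :: idom"
  assumes "x ^ 3 + 3 * x\<^sup>2 - c = 0" "y ^ 3 + 3 * y\<^sup>2 - c = 0" "x \<noteq> y"
  shows "x\<^sup>2 + x * y + y\<^sup>2 + 3 * (x + y) = 0"
proof -
  have "(x - y) * (x\<^sup>2 + x * y + y\<^sup>2 + 3 * (x + y)) = (x ^ 3 + 3 * x\<^sup>2 - c) - (y ^ 3 + 3 * y\<^sup>2 - c)"
    by (simp add: power2_eq_square power3_eq_cube algebra_simps)
  thus ?thesis using assms by simp
qed

text \<open>Distinct roots would make \<open>x (x + 2) + y (y + 2) + ((x + 1) (y + 1) - 1)\<close>
  vanish. Between \<open>-2\<close> and \<open>0\<close> the first two summands are negative and the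
  third is at most 0; below \<open>-2\<close> the signs are reversed.\<close>

lemma cubic_root_unique:
  fixes x y c :: real
  assumes xy: "x ^ 3 + 3 * x\<^sup>2 - c = 0" "y ^ 3 + 3 * y\<^sup>2 - c = 0"
    and cases: "x \<in> {-2<..<0} \<and> y \<in> {-2<..<0} \<or> x < -2 \<and> y < -2"
  shows "x = y"
proof (rule ccontr)
  assume "x \<noteq> y"
  from cubic_difference[OF xy this]
  have eq: "x * (x + 2) + y * (y + 2) + ((x + 1) * (y + 1) - 1) = 0"
    by (simp add: power2_eq_square algebra_simps)
  from cases show False
  proof (elim disjE conjE)
    assume *: "x \<in> {-2<..<0}" "y \<in> {-2<..<0}"
    hence "x * (x + 2) < 0" "y * (y + 2) < 0" by (auto intro: mult_neg_pos)
    moreover have "\<bar>x + 1\<bar> * \<bar>y + 1\<bar> \<le> 1 * 1" using * by (intro mult_mono) auto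
    hence "(x + 1) * (y + 1) \<le> 1" using abs_ge_self[of "(x + 1) * (y + 1)"] by (simp add: abs_mult)
    ultimately show False using eq by linarith
  next
    assume *: "x < -2" "y < -2"
    hence "x * (x + 2) > 0" "y * (y + 2) > 0" by (auto intro: mult_neg_neg)
    moreover have "1 * 1 \<le> (- x - 1) * (- y - 1)" using * by (intro mult_mono) auto
    hence "(x + 1) * (y + 1) \<ge> 1" by (simp add: algebra_simps)
    ultimately show False using eq by linarith
  qed
qed

text \<open>With \<open>t = x + 1\<close> the polynomial \<open>x^3 + 3 x^2\<close> is
  \<open>t^3 - 3 t + 2\<close>, and \<open>t = - 2 cos \<alpha>\<close> brings it to the triple
  angle formula.\<close>

lemma trig_cubic_root:
  fixes \<alpha> :: real
  shows "(- (1 + 2 * cos \<alpha>)) ^ 3 + 3 * (- (1 + 2 * cos \<alpha>))\<^sup>2 - (2 - 2 * cos (3 * \<alpha>)) = 0"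
  unfolding cos_treble_cos by (simp add: power2_eq_square power3_eq_cube algebra_simps)

text \<open>Tripling \<open>2 \<theta> + pi/3\<close> and \<open>2 \<theta> - pi/3\<close> gives
  \<open>6 \<theta> + pi\<close> and \<open>6 \<theta> - pi\<close>, whose cosine is
  \<open>- cos (6 \<theta>)\<close>, so both yield roots. Monotonicity of the cosine places them in
  the prescribed intervals, where a root is unique.\<close>

lemma cubic_roots_trig:
  fixes \<theta> l x2 x3 :: real
  assumes \<theta>: "\<theta> \<in> {0<..<pi/6}" and l: "l = cos (3 * \<theta>)"
    and x2: "- x2 \<in> {-2<..<0}" "(- x2) ^ 3 + 3 * (- x2)\<^sup>2 - 4 * l\<^sup>2 = 0"
    and x3: "- x3 < -2" "(- x3) ^ 3 + 3 * (- x3)\<^sup>2 - 4 * l\<^sup>2 = 0"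
  shows "x2 = 1 + 2 * cos (2 * \<theta> + pi/3)" "x3 = 1 + 2 * cos (2 * \<theta> - pi/3)"
proof -
  have l2: "4 * l\<^sup>2 = 2 + 2 * cos (6 * \<theta>)"
    using cos_double_cos[of "3 * \<theta>"] by (simp add: l)
  have "3 * (2 * \<theta> + pi/3) = 6 * \<theta> + pi" "3 * (2 * \<theta> - pi/3) = 6 * \<theta> - pi"
    by simp_all
  hence "cos (3 * (2 * \<theta> + pi/3)) = - cos (6 * \<theta>)" "cos (3 * (2 * \<theta> - pi/3)) = - cos (6 * \<theta>)"
    by (simp_all only: cos_periodic_pi cos_periodic_pi2 cos_minus_pi)
  hence r: "(- (1 + 2 * cos (2 * \<theta> + pi/3))) ^ 3 + 3 * (- (1 + 2 * cos (2 * \<theta> + pi/3)))\<^sup>2 - 4 * l\<^sup>2 = 0"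
    "(- (1 + 2 * cos (2 * \<theta> - pi/3))) ^ 3 + 3 * (- (1 + 2 * cos (2 * \<theta> - pi/3)))\<^sup>2 - 4 * l\<^sup>2 = 0"
    using trig_cubic_root[of "2 * \<theta> + pi/3"] trig_cubic_root[of "2 * \<theta> - pi/3"] unfolding l2 by simp_all
  have "cos (2 * \<theta> + pi/3) < cos (pi/3)" "cos (2 * pi/3) < cos (2 * \<theta> + pi/3)"
    using \<theta> by (auto intro!: cos_monotone_0_pi)
  hence b2: "- (1 + 2 * cos (2 * \<theta> + pi/3)) \<in> {-2<..<0}"
    by (simp add: cos_60 cos_120)
  have "cos (pi/3) < cos (pi/3 - 2 * \<theta>)"
    using \<theta> by (auto intro!: cos_monotone_0_pi)
  also have "cos (pi/3 - 2 * \<theta>) = cos (2 * \<theta> - pi/3)"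
    using cos_minus[of "2 * \<theta> - pi/3"] by simp
  finally have b3: "- (1 + 2 * cos (2 * \<theta> - pi/3)) < -2"
    by (simp add: cos_60)
  show "x2 = 1 + 2 * cos (2 * \<theta> + pi/3)"
    using cubic_root_unique[OF x2(2) r(1)] x2(1) b2 by simp
  show "x3 = 1 + 2 * cos (2 * \<theta> - pi/3)"
    using cubic_root_unique[OF x3(2) r(2)] x3(1) b3 by simp
qed

text \<open>The roots of this cubic sum to \<open>-3\<close>, so the third one is
  \<open>- 3 - x - y\<close>.\<close>

lemma cubic_three_roots:
  fixes x y c :: "'a :: idom"
  assumes "x ^ 3 + 3 * x\<^sup>2 - c = 0" "y ^ 3 + 3 * y\<^sup>2 - c = 0" "x \<noteq> y"
  shows "t ^ 3 + 3 * t\<^sup>2 - c = (t - x) * (t - y) * (t + 3 + x + y)"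
proof -
  have c: "c = x ^ 3 + 3 * x\<^sup>2" using assms(1) by simp
  have "t ^ 3 + 3 * t\<^sup>2 - c - (t - x) * (t - y) * (t + 3 + x + y)
      = (t - x) * (x\<^sup>2 + x * y + y\<^sup>2 + 3 * (x + y))"
    unfolding c by (simp add: power2_eq_square power3_eq_cube algebra_simps)
  thus ?thesis using cubic_difference[OF assms] by simp
qed

text \<open>The substitution \<open>p = c / w - 1/3\<close> with \<open>w = 1 - d\<close> and \<open>c = 4\<kappa>\<^sup>2/9\<close> carries the cubic in \<open>d\<close> to
  the Weierstrass cubic; as \<open>9c\<close> is the product of the three values of \<open>w\<close>, each \<open>c / w\<close> is a
  polynomial in the other two.\<close>

lemma weierstrass_cubic_factor:
  fixes w1 w2 w3 k l2 x :: "'a :: field_char_0"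
  assumes "w1 + w2 + w3 = 6" "w1 * w2 + w1 * w3 + w2 * w3 = 9" "w1 * w2 * w3 = 4 * k" "k + l2 = 1"
  shows "4 * x ^ 3 - 4/27 * (1 + 8 * l2) * x - 8/729 * (8 * l2\<^sup>2 + 20 * l2 - 1)
       = 4 * ((x - (w2 * w3 / 9 - 1/3)) * (x - (w1 * w3 / 9 - 1/3)) * (x - (w1 * w2 / 9 - 1/3)))"
proof -
  define q where "q = x + 1/3"
  have l2: "l2 = 1 - k" using assms(4) by (simp add: algebra_simps)
  have x: "x = q - 1/3" by (simp add: q_def)
  \<comment> \<open>In \<open>q\<close> the roots are the products of two of the \<open>w\<close>
    over 9; their elementary symmetric functions are polynomials in those of \<open>w1\<close>,
    \<open>w2\<close>, \<open>w3\<close>.\<close>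
  have "(x - (w2 * w3 / 9 - 1/3)) * (x - (w1 * w3 / 9 - 1/3)) * (x - (w1 * w2 / 9 - 1/3))
      = q ^ 3 - q\<^sup>2 * ((w1 * w2 + w1 * w3 + w2 * w3) / 9) + q * ((w1 * w2 * w3) * (w1 + w2 + w3) / 81)
        - (w1 * w2 * w3)\<^sup>2 / 729"
    unfolding x by (simp add: field_simps power2_eq_square power3_eq_cube)
  also have "\<dots> = q ^ 3 - q\<^sup>2 + q * (8/27 * k) - 16/729 * k\<^sup>2"
    unfolding assms(1-3) by (simp add: power2_eq_square)
  finally show ?thesis
    by (simp only:) (simp add: l2 x field_simps power2_eq_square power3_eq_cube)
qed

text \<open>For \<open>d = 1 - 4/9 k W\<close> one has \<open>d'' = - 4/9 k W''\<close>, so this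
  identity turns the equation of the reciprocal with shift \<open>1/3\<close> into that of
  \<open>dn3\<close>.\<close>

lemma recip_ode_to_dn3:
  fixes W k L g2 g3 :: complex
  assumes "k = (of_real \<kappa>)\<^sup>2" "k + L = 1" "g2 = 4/27 * (1 + 8 * L)" "g3 = 8/729 * (8 * L\<^sup>2 + 20 * L - 1)"
  shows "- (4/9 * k) * poly (wp_recip_poly (1/3) g2 g3) W = poly (dn3_ode_poly \<kappa>) (1 - 4/9 * k * W)"
proof -
  have "L = 1 - k" using assms(2) by (simp add: algebra_simps)
  show ?thesis
    unfolding wp_recip_poly_def dn3_ode_poly_def assms(3,4) assms(1)[symmetric] \<open>L = 1 - k\<close>
    by (simp add: field_simps power2_eq_square power3_eq_cube)
qed

text \<open>Both sides solve the same initial value problem at \<open>0\<close>. Punctured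
  neighbourhoods appear because the total expression on the right misbehaves at exceptional points:
  at a pole of \<open>P\<close> it is evaluated with \<open>P = 0\<close>, and where
  \<open>P = -1/3\<close> with \<open>inverse 0 = 0\<close>.\<close>

lemma dn3_eq_weierstrass:
  fixes \<kappa> :: real and L g2 g3 :: complex
  assumes wp: "is_weierstrass_p g2 g3 P"
    and \<kappa>: "\<bar>\<kappa>\<bar> < 1" and L: "(of_real \<kappa>)\<^sup>2 + L = 1"
    and g: "g2 = 4/27 * (1 + 8 * L)" "g3 = 8/729 * (8 * L\<^sup>2 + 20 * L - 1)"
    and \<phi>: "analytic_local_inverse_at_0 (hypergeo_integral \<kappa>) \<phi>"
    and dn3: "dn3 nicely_meromorphic_on UNIV" "\<forall>\<^sub>F z in nhds 0. dn3 z = deriv \<phi> z"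
  shows "\<forall>\<^sub>F w in at z. dn3 w = 1 - 4/9 * (of_real \<kappa>)\<^sup>2 * inverse (P w + 1/3)"
proof -
  interpret weierstrass_p g2 g3 P by standard (rule wp)
  define c where "c = 4/9 * (complex_of_real \<kappa>)\<^sup>2"
  define W where "W = wp_recip (1/3) P"
  obtain d where d: "\<forall>\<^sub>F z in nhds 0. deriv \<phi> z = d z" "d analytic_on {0}" "d 0 = 1" "deriv d 0 = 0"
    "\<forall>\<^sub>F z in nhds 0. deriv (deriv d) z = poly (dn3_ode_poly \<kappa>) (d z)"
    using deriv_local_inverse_ode[OF \<kappa> \<phi>] by blast
  have odeP: "\<forall>\<^sub>F z in at 0. (deriv P z)\<^sup>2 = 4 * P z ^ 3 - g2 * P z - g3"
    using eventually_not_pole_at by eventually_elim (rule ode)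
  note W = wp_recip_ode[OF isolated pole_0 odeP, of "1/3", folded W_def]
  define V where "V z = 1 - c * W z" for z
  have evW: "\<forall>\<^sub>F z in nhds 0. W analytic_on {z}"
    by (rule eventually_analytic_at[OF W(1)])
  have dV: "deriv V z = - c * deriv W z" if "W analytic_on {z}" for z
  proof -
    have "(W has_field_derivative deriv W z) (at z)"
      using that analytic_on_imp_differentiable_at DERIV_deriv_iff_field_differentiable by blast
    hence "(V has_field_derivative - c * deriv W z) (at z)"
      unfolding V_def [abs_def] by (auto intro!: derivative_eq_intros)
    thus ?thesis by (rule DERIV_imp_deriv)
  qed
  have "\<forall>\<^sub>F z in nhds 0. d z = V z"
  proof (rule analytic_second_order_ode_unique[OF d(2) _ _ _ d(5)])
    show "V analytic_on {0}" unfolding V_def [abs_def] using W(1) by (intro analytic_intros)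
    show "d 0 = V 0" using d(3) W(2) by (simp add: V_def)
    show "deriv d 0 = deriv V 0" using d(4) W(1,3) by (simp add: dV)
    have "\<forall>\<^sub>F z in nhds 0. \<forall>\<^sub>F w in nhds z. W analytic_on {w}"
      using evW by (simp add: eventually_eventually)
    thus "\<forall>\<^sub>F z in nhds 0. deriv (deriv V) z = poly (dn3_ode_poly \<kappa>) (V z)"
      using evW W(4)
    proof eventually_elim
      case (elim z)
      have "deriv W analytic_on {z}" using elim(2) by (rule analytic_deriv)
      hence "(deriv W has_field_derivative deriv (deriv W) z) (at z)"
        using analytic_on_imp_differentiable_at DERIV_deriv_iff_field_differentiable by blast
      hence "((\<lambda>w. - c * deriv W w) has_field_derivative - c * deriv (deriv W) z) (at z)"
        by (rule DERIV_cmult)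
      moreover have "\<forall>\<^sub>F w in nhds z. deriv V w = - c * deriv W w"
        using elim(1) by eventually_elim (rule dV)
      ultimately have "(deriv V has_field_derivative - c * deriv (deriv W) z) (at z)"
        by (rule DERIV_eventually_eqI)
      hence "deriv (deriv V) z = - c * poly (wp_recip_poly (1/3) g2 g3) (W z)"
        unfolding elim(3) by (rule DERIV_imp_deriv)
      thus ?case
        using recip_ode_to_dn3[OF refl L g, of "W z"] by (simp add: c_def V_def)
    qed
  qed
  with dn3(2) d(1) have "\<forall>\<^sub>F z in nhds 0. dn3 z = V z" by eventually_elim simp
  hence "\<forall>\<^sub>F w in at 0. dn3 w = 1 - c * inverse (P w + 1/3)"
    unfolding eventually_at_filter by (rule eventually_mono) (simp add: V_def W_def wp_recip_def)
  hence "\<forall>\<^sub>F w in at z. dn3 w = 1 - c * inverse (P w + 1/3)"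
  proof (rule meromorphic_identity[rotated 2])
    show "dn3 meromorphic_on UNIV" using dn3(1) by (simp add: nicely_meromorphic_on_def)
    show "(\<lambda>w. 1 - c * inverse (P w + 1/3)) meromorphic_on UNIV"
      using mero by (intro meromorphic_intros)
  qed
  thus ?thesis by (simp add: c_def)
qed

section \<open>Values and critical points of a function \<open>1 - c / (P + a)\<close>\<close>

locale dn3_weierstrass = weierstrass_p +
  fixes c a :: complex and f :: "complex \<Rightarrow> complex"
  assumes nice_f: "f nicely_meromorphic_on UNIV" and c: "c \<noteq> 0"
    and f_eq: "\<And>z. \<forall>\<^sub>F w in at z. f w = 1 - c * inverse (P w + a)"
begin

lemma value_regular:
  assumes "\<not> is_pole P z" "P z \<noteq> - a"
  shows "f z = 1 - c * inverse (P z + a)"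
proof (rule nicely_meromorphic_value[OF nice_f])
  have "P \<midarrow>z\<rightarrow> P z" by (rule nicely_meromorphic_tendsto[OF nice assms(1)])
  hence "(\<lambda>w. 1 - c * inverse (P w + a)) \<midarrow>z\<rightarrow> 1 - c * inverse (P z + a)"
    using assms(2) by (intro tendsto_intros) (auto simp: add_eq_0_iff2)
  thus "f \<midarrow>z\<rightarrow> 1 - c * inverse (P z + a)"
    using tendsto_cong[OF f_eq] by blast
qed

lemma value_pole:
  assumes "is_pole P z"
  shows "f z = 1"
proof (rule nicely_meromorphic_value[OF nice_f])
  have "is_pole (\<lambda>w. P w + a) z" using assms is_pole_plus_const_iff by blast
  from is_pole_tendsto[OF this]
  have "(\<lambda>w. 1 - c * inverse (P w + a)) \<midarrow>z\<rightarrow> 1 - c * 0"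
    by (intro tendsto_intros) (simp add: o_def)
  hence "(\<lambda>w. 1 - c * inverse (P w + a)) \<midarrow>z\<rightarrow> 1" by simp
  thus "f \<midarrow>z\<rightarrow> 1" using tendsto_cong[OF f_eq] by blast
qed

text \<open>Near \<open>z\<close> the product \<open>(1 - f) (P + a)\<close> is the nonzero constant
  \<open>c\<close>, whereas continuity of \<open>f\<close> would make it tend to
  \<open>0\<close>.\<close>

lemma not_continuous:
  assumes "\<not> is_pole P z" "P z = - a"
  shows "\<not> isCont f z"
proof
  assume "isCont f z"
  hence "f \<midarrow>z\<rightarrow> f z" by (simp add: isCont_def)
  moreover have "P \<midarrow>z\<rightarrow> - a" using nicely_meromorphic_tendsto[OF nice assms(1)] assms(2) by simp
  ultimately have "(\<lambda>w. (1 - f w) * (P w + a)) \<midarrow>z\<rightarrow> (1 - f z) * (- a + a)"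
    by (intro tendsto_intros)
  moreover have "\<forall>\<^sub>F w in at z. (1 - f w) * (P w + a) = c"
    using f_eq[of z] eventually_avoids[of "- a" z]
    by eventually_elim (simp add: add_eq_0_iff2)
  ultimately have "(\<lambda>w. c) \<midarrow>z\<rightarrow> 0" by (simp add: tendsto_cong)
  thus False using c by (simp add: tendsto_const_iff)
qed

lemma DERIV_regular:
  assumes "\<not> is_pole P z" "P z \<noteq> - a"
  shows "(f has_field_derivative c * deriv P z / (P z + a)\<^sup>2) (at z)"
proof -
  have nz: "P z + a \<noteq> 0" using assms(2) by (simp add: add_eq_0_iff2)
  have "((\<lambda>w. 1 - c * inverse (P w + a)) has_field_derivative c * deriv P z / (P z + a)\<^sup>2) (at z)"
    using DERIV[OF assms(1)] nz
    by (auto intro!: derivative_eq_intros simp: field_simps power2_eq_square)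
  moreover have "\<forall>\<^sub>F w in nhds z. f w = 1 - c * inverse (P w + a)"
    using f_eq[of z] value_regular[OF assms] unfolding eventually_at_filter
    by (auto elim: eventually_mono)
  ultimately show ?thesis by (rule DERIV_eventually_eqI)
qed

text \<open>A value other than 1 excludes the poles of \<open>P\<close>, and differentiability
  excludes \<open>P = - a\<close>. Elsewhere \<open>f' = c P' / (P + a)^2\<close>, so
  \<open>P'\<close> must vanish.\<close>

lemma critical_pointD:
  assumes "critical_point f z" "f z \<noteq> 1"
  shows "\<not> is_pole P z" "P z \<noteq> - a" "deriv P z = 0"
proof -
  show np: "\<not> is_pole P z" using value_pole assms(2) by blast
  have "isCont f z" using assms(1) DERIV_isCont by (auto simp: critical_point_def)
  thus ne: "P z \<noteq> - a" using not_continuous[OF np] by blast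
  have "c * deriv P z / (P z + a)\<^sup>2 = 0"
    using DERIV_unique[OF DERIV_regular[OF np ne]] assms(1) by (simp add: critical_point_def)
  thus "deriv P z = 0" using c ne by (simp add: add_eq_0_iff2)
qed

lemma critical_pointI:
  assumes "\<not> is_pole P z" "P z \<noteq> - a" "deriv P z = 0"
  shows "critical_point f z"
  using DERIV_regular[OF assms(1,2)] assms(3) by (simp add: critical_point_def)

end

theorem theorem6:
  fixes \<kappa> l \<theta> x2 x3 K K' :: real
    and \<phi> dn3 P :: "complex \<Rightarrow> complex"
  assumes "\<kappa> \<in> {0<..<1}" and "l \<in> {0<..<1}" and "\<kappa>\<^sup>2 + l\<^sup>2 = 1"
    and "analytic_local_inverse_at_0 (hypergeo_integral \<kappa>) \<phi>"
    and "elliptic dn3" and "\<forall>\<^sub>F z in nhds 0. dn3 z = deriv \<phi> z"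
    and "is_weierstrass_p (of_real (4/27 * (1 + 8 * l\<^sup>2)))
           (of_real (8/729 * (8 * l ^ 4 + 20 * l\<^sup>2 - 1))) P"
    and "K > 0" and "K' > 0"
    and "period_lattice P = {2 * of_int m * of_real K + 2 * of_int n * \<i> * of_real K' | m n :: int. True}"
    and "\<theta> \<in> {0<..<pi/6}" and "l = cos (3 * \<theta>)"
    and "- x2 \<in> {-2<..<0}" and "(- x2) ^ 3 + 3 * (- x2)\<^sup>2 - 4 * l\<^sup>2 = 0"
    and "- x3 \<in> {-3<..<-2}" and "(- x3) ^ 3 + 3 * (- x3)\<^sup>2 - 4 * l\<^sup>2 = 0"
  shows "critical_point dn3 (of_real K + \<i> * of_real K') \<and>
         dn3 (of_real K + \<i> * of_real K') = of_real (- x2) \<and>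
         critical_point dn3 (\<i> * of_real K') \<and>
         dn3 (\<i> * of_real K') = of_real (- x3) \<and>
         {v :: real. v < 0 \<and> of_real v \<in> critical_values dn3} = {- x2, - x3} \<and>
         x2 = 1 + 2 * cos (2 * \<theta> + pi/3) \<and>
         1 + 2 * cos (2 * \<theta> + pi/3) = 1 + cos (2 * \<theta>) - sqrt 3 * sin (2 * \<theta>) \<and>
         x3 = 1 + 2 * cos (2 * \<theta> - pi/3) \<and>
         1 + 2 * cos (2 * \<theta> - pi/3) = 1 + cos (2 * \<theta>) + sqrt 3 * sin (2 * \<theta>)"
proof -
  \<comment> \<open>The third root of the cubic is \<open>x2 + x3 - 3\<close>. The numbers
    \<open>w1\<close>, \<open>w2\<close>, \<open>w3\<close> are \<open>1 - d\<close> for the roots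
    \<open>d\<close> equal to \<open>x2 + x3 - 3\<close>, \<open>- x2\<close>,
    \<open>- x3\<close>.\<close>
  define w1 w2 w3 where "w1 = 4 - x2 - x3" and "w2 = 1 + x2" and "w3 = 1 + x3"
  \<comment> \<open>These are \<open>c / w1 - 1/3\<close> and so on, written without division by
    means of \<open>w1 w2 w3 = 9 c\<close>. Hence the order of the \<open>e\<close> is opposite to
    that of the \<open>w\<close>.\<close>
  define e1 e2 e3 where "e1 = w2 * w3 / 9 - 1/3" and "e2 = w1 * w3 / 9 - 1/3" and "e3 = w1 * w2 / 9 - 1/3"
  define c :: complex where "c = 4/9 * (of_real \<kappa>)\<^sup>2"
  have x23: "0 < x2" "x2 < 2" "2 < x3" "x3 < 3" using assms(13,15) by auto
  have k: "\<kappa>\<^sup>2 = 1 - l\<^sup>2" using assms(3) by simp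
  have root: "t ^ 3 + 3 * t\<^sup>2 - 4 * l\<^sup>2 = (t + x2) * (t + x3) * (t + 3 - x2 - x3)" for t
    using cubic_three_roots[OF assms(14,16), of t] x23 by simp
  have w: "w1 + w2 + w3 = 6" "w1 * w2 + w1 * w3 + w2 * w3 = 9" "w1 * w2 * w3 = 4 * \<kappa>\<^sup>2"
  proof -
    show "w1 + w2 + w3 = 6" by (simp add: w1_def w2_def w3_def)
    have "(- x2) * (- x2) + x2 * x3 + (- x3) * (- x3) - 3 * (x2 + x3) = 0"
      using cubic_difference[OF assms(14,16)] x23 by (simp add: power2_eq_square)
    thus "w1 * w2 + w1 * w3 + w2 * w3 = 9" by (simp add: w1_def w2_def w3_def algebra_simps)
    show "w1 * w2 * w3 = 4 * \<kappa>\<^sup>2"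
      using root[of 1] unfolding k by (simp add: w1_def w2_def w3_def algebra_simps)
  qed
  have w_pos: "0 < w2" "0 < w3" using x23 by (auto simp: w1_def w2_def w3_def)
  have "0 < w1 * (w2 * w3)" using w(3) assms(1) by (simp add: mult.assoc)
  hence "0 < w1" by (rule zero_less_mult_pos2) (use w_pos in simp)
  \<comment> \<open>The factored cubic at \<open>0\<close> gives
    \<open>4 l^2 = x2 x3 (x2 + x3 - 3)\<close>, so the third root is positive and
    \<open>w1 < 1\<close>.\<close>
  have "0 < (x2 * x3) * (x2 + x3 - 3)"
    using root[of 0] assms(2) by (simp add: algebra_simps)
  hence "0 < x2 + x3 - 3" by (rule zero_less_mult_pos) (use x23 in simp)
  hence w_less: "w1 < 1" "1 < w2" "w2 < w3" using x23 by (auto simp: w1_def w2_def w3_def)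
  have roots: "e3 < e2" "e2 < e1"
    using w_less \<open>0 < w1\<close> w_pos by (simp_all add: e1_def e2_def e3_def)
  have cubic: "4 * x ^ 3 - of_real (4/27 * (1 + 8 * l\<^sup>2)) * x - of_real (8/729 * (8 * l ^ 4 + 20 * l\<^sup>2 - 1))
      = 4 * ((x - of_real e1) * (x - of_real e2) * (x - of_real e3))" for x :: complex
  proof -
    have "complex_of_real w1 + of_real w2 + of_real w3 = 6"
      "complex_of_real w1 * of_real w2 + of_real w1 * of_real w3 + of_real w2 * of_real w3 = 9"
      "complex_of_real w1 * of_real w2 * of_real w3 = 4 * (of_real \<kappa>)\<^sup>2"
      "(complex_of_real \<kappa>)\<^sup>2 + (of_real l)\<^sup>2 = 1"
      using w[THEN arg_cong[where f = complex_of_real]] assms(3)[THEN arg_cong[where f = complex_of_real]]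
      by simp_all
    from weierstrass_cubic_factor[OF this, of x] show ?thesis
      by (simp add: e1_def e2_def e3_def)
  qed
  interpret rectangular_weierstrass_p "4/27 * (1 + 8 * l\<^sup>2)" "8/729 * (8 * l ^ 4 + 20 * l\<^sup>2 - 1)" P K K' e1 e2 e3
    using assms(7-10) roots cubic by unfold_locales
  have nice3: "dn3 nicely_meromorphic_on UNIV" using assms(5) by (simp add: elliptic_def)
  have f_eq: "\<forall>\<^sub>F w in at z. dn3 w = 1 - c * inverse (P w + 1/3)" for z
    unfolding c_def
    by (rule dn3_eq_weierstrass[OF assms(7) _ _ _ _ assms(4) nice3 assms(6), where L = "(of_real l)\<^sup>2"])
       (use assms(1) assms(3)[THEN arg_cong[where f = complex_of_real]] in \<open>simp_all flip: power_mult\<close>)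
  interpret dn3_weierstrass "of_real (4/27 * (1 + 8 * l\<^sup>2))" "of_real (8/729 * (8 * l ^ 4 + 20 * l\<^sup>2 - 1))" P c "1/3" dn3
    using nice3 f_eq assms(1) by unfold_locales (auto simp: c_def)
  have c_eq: "c = of_real (w1 * w2 * w3 / 9)" by (simp add: c_def w(3))
  \<comment> \<open>In the applications \<open>v\<close> is the product of the two numbers other
    than \<open>w\<close>. Then \<open>w v = 9 c\<close>, so \<open>P z + 1/3 = v / 9\<close> yields
    \<open>c / (P z + 1/3) = w\<close>.\<close>
  have val: "dn3 z = of_real (1 - w)" "critical_point dn3 z"
    if "\<not> is_pole P z" "deriv P z = 0" "P z = of_real (v / 9 - 1/3)" "w * v = w1 * w2 * w3" for z w v
  proof -
    have "v \<noteq> 0" using that(4) \<open>0 < w1\<close> w_pos by auto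
    hence ne: "P z \<noteq> - (1/3)" unfolding that(3) by (simp add: complex_eq_iff)
    show "critical_point dn3 z" using critical_pointI that ne by simp
    have "P z + 1/3 = of_real (v / 9)" unfolding that(3) by simp
    hence "dn3 z = 1 - of_real (w * v / 9) * inverse (of_real (v / 9))"
      using value_regular[OF that(1)] ne by (simp only: c_eq that(4) simp_thms)
    also have "\<dots> = of_real (1 - w)" using \<open>v \<noteq> 0\<close> by (simp add: field_simps)
    finally show "dn3 z = of_real (1 - w)" .
  qed
  have half: "\<not> is_pole P (of_real K + \<i> * of_real K')" "\<not> is_pole P (\<i> * of_real K')"
    "deriv P (of_real K + \<i> * of_real K') = 0" "deriv P (\<i> * of_real K') = 0"
  proof -
    show 1: "\<not> is_pole P (of_real K + \<i> * of_real K')" using K K' by (intro not_pole_Re) auto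
    show 2: "\<not> is_pole P (\<i> * of_real K')" using K K' by (intro not_pole_Im) auto
    show "deriv P (of_real K + \<i> * of_real K') = 0"
      using periodI[of 1 1] by (intro half_period_critical 1) (simp add: algebra_simps)
    show "deriv P (\<i> * of_real K') = 0"
      using periodI[of 0 1] by (intro half_period_critical 2) (simp add: algebra_simps)
  qed
  have v2: "dn3 (of_real K + \<i> * of_real K') = of_real (1 - w2)" "critical_point dn3 (of_real K + \<i> * of_real K')"
    using val[of _ "w1 * w3" w2, OF half(1,3)] value_K_iK' by (simp_all add: e1_def e2_def e3_def mult_ac)
  have v3: "dn3 (\<i> * of_real K') = of_real (1 - w3)" "critical_point dn3 (\<i> * of_real K')"
    using val[of _ "w1 * w2" w3, OF half(2,4)] value_iK' by (simp_all add: e1_def e2_def e3_def mult_ac)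
  have "v = 1 - w2 \<or> v = 1 - w3" if v: "v < 0" "of_real v \<in> critical_values dn3" for v
  proof -
    obtain z where z: "critical_point dn3 z" "dn3 z = of_real v"
      using v(2) by (auto simp: critical_values_def)
    have "dn3 z \<noteq> 1" using v(1) z(2) by (auto simp: complex_eq_iff)
    note cp = critical_pointD[OF z(1) this]
    have "P z = of_real e1 \<or> P z = of_real e2 \<or> P z = of_real e3"
      using ode[OF cp(1)] unfolding cubic cp(3) by auto
    hence "dn3 z = of_real (1 - w1) \<or> dn3 z = of_real (1 - w2) \<or> dn3 z = of_real (1 - w3)"
      using val(1)[OF cp(1,3), of "w2 * w3" w1] val(1)[OF cp(1,3), of "w1 * w3" w2] val(1)[OF cp(1,3), of "w1 * w2" w3]
      by (auto simp: e1_def e2_def e3_def mult_ac)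
    \<comment> \<open>The root \<open>e1\<close> would give the value \<open>1 - w1\<close>, which
      is positive.\<close>
    thus ?thesis using z(2) v(1) w_less(1) by (auto simp: of_real_eq_iff simp del: of_real_diff)
  qed
  moreover have "1 - w2 < 0" "1 - w3 < 0" using w_less by auto
  moreover have "of_real (1 - w2) \<in> critical_values dn3" "of_real (1 - w3) \<in> critical_values dn3"
    using v2 v3 unfolding critical_values_def by (metis (mono_tags) imageI mem_Collect_eq)+
  ultimately have crit: "{v :: real. v < 0 \<and> of_real v \<in> critical_values dn3} = {1 - w2, 1 - w3}"
    by auto
  have x: "1 - w2 = - x2" "1 - w3 = - x3" by (simp_all add: w2_def w3_def)
  have trig: "x2 = 1 + 2 * cos (2 * \<theta> + pi/3)" "x3 = 1 + 2 * cos (2 * \<theta> - pi/3)"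
    using cubic_roots_trig[OF assms(11-14) _ assms(16)] assms(15) by auto
  have trig': "1 + 2 * cos (2 * \<theta> + pi/3) = 1 + cos (2 * \<theta>) - sqrt 3 * sin (2 * \<theta>)"
    "1 + 2 * cos (2 * \<theta> - pi/3) = 1 + cos (2 * \<theta>) + sqrt 3 * sin (2 * \<theta>)"
    by (simp_all add: cos_add cos_diff cos_60 sin_60)
  show ?thesis
    by (intro conjI v2[unfolded x] v3[unfolded x] crit[unfolded x] trig trig')
qed

end
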